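(* Let $\theta=(\theta_S,\theta_B)$ be a pair of non-negative parameters, and assume that $\theta_B$ is positive. Then the optimal control problem $$\inf_{\mathbf u\in \mathcal U_{ad}} \mathcal J_\theta(\mathbf u),\qquad \mathcal J_\theta(\mathbf u)=C_T(\mathbf u)+\frac{\theta_S}{2}S(\mathbf u)+\theta_B B(\mathbf u),$$ has a solution, i.e. there exists $\mathbf u^*\in\mathcal U_{ad}$ such that $\mathcal J_\theta(\mathbf u^* )=\inf_{\mathbf u\in\mathcal U_{ad}}\mathcal J_\theta(\mathbf u)$.
   Context: **Network and discretization.** A road network is a directed graph with $N_r\in\mathbb N^*$ roads (edges), indexed by $i\in\{1,\dots,N_r\}$; its vertices are called junctions. For a junction $J$, $J_{\rm in}$ and $J_{\rm out}$ are the sets of indices of the roads entering and leaving $J$; only junctions with one or two ingoing roads and one or two outgoing roads are considered. Each road is divided into $N_c\in\mathbb N^*$ cells of lengths $\Delta x_{i,j}>0$, $1\le j\le N_c$. The state is the vector of densities $\boldsymbol\rho=(\rho_{i,j})_{1\le i\le N_r,1\le j\le N_c}$. The boundary fluxes are $\boldsymbol\gamma=(\gamma_1^L,\gamma_1^R,\dots,\gamma_{N_r}^L,\gamma_{N_r}^R)$ ($L$: entrance of the road, $R$: end of the road). The maximal speeds and densities allowed on the roads are normalized to $1$: the flux on each road is $f_i(\rho)=\rho(1-\rho)$. **Numerical flux and finite volume field.** $$\mathcal F_i(u,v)=\frac{f_i(u)+f_i(v)}2-\max\{|f_i'(u)|,|f_i'(v)|\}\frac{v-u}{2},$$ $$f^{FV}(\boldsymbol\rho,\boldsymbol\gamma)_{i,j}=\begin{cases}-\frac1{\Delta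 x_{i,j}}\big(\mathcal F_i(\rho_{i,j},\rho_{i,j+1})-\gamma_i^L\big)& j=1,\\ -\frac1{\Delta x_{i,j}}\big(\mathcal F_i(\rho_{i,j},\rho_{i,j+1})-\mathcal F_i(\rho_{i,j-1},\rho_{i,j})\big)&2\le j\le N_c-1,\\ -\frac1{\Delta x_{i,j}}\big(\gamma_i^R-\mathcal F_i(\rho_{i,j-1},\rho_{i,j})\big)&j=N_c.\end{cases}$$ **Junction fluxes.** Set $\gamma_i^{R,\max}=f_i(\min\{\rho_{i,N_c},1/2\})$ and $\gamma_i^{L,\max}=f_i(\max\{\rho_{i,1},1/2\})$. For a control value $\mathbf u\in[0,1]^{N_r}$ and a junction $J$, let $A_J(\mathbf u)=(\alpha_{ji}(\mathbf u))_{(j,i)\in J_{\rm out}\times J_{\rm in}}$ be the statistical behavior matrix ($\alpha_{ji}$ is the proportion of vehicles going to the outgoing road $j$ among those coming from the ingoing road $i$), which the model lets depend on the control so that traffic is deviated away from closed outgoing roads, and let $$\Omega_J(\mathbf u)=\Big\{\big((\gamma_i^R)_{i\in J_{\rm in}},(\gamma_j^L)_{j\in J_{\rm out}}\big)\in\prod_{i\in J_{\rm in}}[0,\gamma_i^{R,\max}]\times\prod_{j\in J_{\rm out}}[0,(1-u_j)\gamma_j^{L,\max}]\ :\ (\gamma_j^L)_{j\in J_{\rm out}}=A_J(\mathbf u)(\gamma_i^R)_{i\in J_{\rm in}}\Big\}.$$ In the model, the fluxes at each junction maximize $\sum_{i\in J_{\rm in}}\gamma_i^R$ over $\Omega_J(\mathbf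 u)$ (this linear program is supposed to have a unique solution), and the simultaneous resolution at all junctions is written $\boldsymbol\gamma=\phi^{LP}(\boldsymbol\rho,\mathbf u)$. In the analysis this map is replaced by a regular approximation, still denoted $\phi^{LP}$, on which the standing assumption is: the function $\phi^{LP}$, of the variables $(\boldsymbol\rho,\mathbf u)\in\mathbb R^{N_r\times N_c}\times[0,1]^{N_r}$, is Lipschitz, and $C^1$ with respect to its second variable $\mathbf u$. **Controlled system.** Fix $T>0$ and an initial density $\boldsymbol\rho_0$. For $\mathbf u\in\mathcal U_{ad}:=L^\infty([0,T],[0,1]^{N_r})$, $\boldsymbol\rho(\cdot;\mathbf u)$ denotes the solution of $$\boldsymbol\rho'(t)=f^{FV}(\boldsymbol\rho(t),\boldsymbol\gamma(t)),\quad \boldsymbol\gamma(t)=\phi^{LP}(\boldsymbol\rho(t),\mathbf u(t)),\quad t\in(0,T),\qquad \boldsymbol\rho(0)=\boldsymbol\rho_0 .$$ **Cost.** Let $\chi_{\rm path}\subset\{1,\dots,N_r\}$ be a given set of roads and $N_{\max}\in\mathbb N^*$. Then $$C_T(\mathbf u)=\sum_{i\in\chi_{\rm path}}\sum_{j=1}^{N_c}\rho_{i,j}(T;\mathbf u),\qquad S(\mathbf u)=\int_0^T\Big(\sum_{i=1}^{N_r}u_i(t)-N_{\max}\Big)_+^2dt,\qquad B(\mathbf u)=\sum_{i=1}^{N_r}\operatorname{TV}(u_i),$$ where $x_+=\max\{x,0\}$ and, for $f\in L^1(0,T)$, $\operatorname{TV}(f)=\sup\{\int_0^Tf\phi'\,dt:\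 \phi\in C^1_c((0,T)),\ \|\phi\|_{L^\infty}\le1\}$. *)

theory Defs
  imports "HOL-Analysis.Analysis"
begin

text \<open>
  Roads are indexed by a finite type \<open>'r\<close>. The cells of a road are indexed by a finite
  linearly ordered type \<open>'c\<close>, listed in the driving direction, so that \<open>Min UNIV\<close> and
  \<open>Max UNIV\<close> play the roles of the cells \<open>1\<close> and \<open>N\<^sub>c\<close>. A density is an element of
  \<open>real^'c^'r\<close>, and boundary fluxes are a pair consisting of the vector of the entrance
  fluxes (\<open>L\<close>) and the vector of the exit fluxes (\<open>R\<close>) of all roads.
  The network geometry enters the dynamics only through the junction map \<open>\<phi>\<close>, which is an
  arbitrary map subject to \<open>regular_junction_map\<close> below.
\<close>

type_synonym ('c, 'r) densities = "((real, 'c) vec, 'r) vec"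
type_synonym 'r controls = "(real, 'r) vec"
type_synonym 'r fluxes = "(real, 'r) vec \<times> (real, 'r) vec"

definition road_flux :: "real \<Rightarrow> real" where
  "road_flux r = r * (1 - r)"

definition num_flux :: "real \<Rightarrow> real \<Rightarrow> real" where
  "num_flux u v = (road_flux u + road_flux v) / 2
     - max \<bar>deriv road_flux u\<bar> \<bar>deriv road_flux v\<bar> * ((v - u) / 2)"

definition next_cell :: "'c::{finite,linorder} \<Rightarrow> 'c" where
  "next_cell j = Min {k. j < k}"

definition prev_cell :: "'c::{finite,linorder} \<Rightarrow> 'c" where
  "prev_cell j = Max {k. k < j}"

text \<open>
  For at least two cells the two conditionals below reproduce the usual three cases (first,
  interior, last cell). For a single cell both boundary fluxes act on it.
\<close>

definition fv_field ::
    "('r \<Rightarrow> 'c \<Rightarrow> real) \<Rightarrow> ('c, 'r) densities \<Rightarrow> 'r fluxes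
       \<Rightarrow> ('c::{finite,linorder}, 'r::finite) densities" where
  "fv_field \<Delta>x \<rho> \<gamma> = (\<chi> i. \<chi> j. - (1 / \<Delta>x i j) *
     ((if j = Max UNIV then snd \<gamma> $ i else num_flux (\<rho> $ i $ j) (\<rho> $ i $ next_cell j))
      - (if j = Min UNIV then fst \<gamma> $ i else num_flux (\<rho> $ i $ prev_cell j) (\<rho> $ i $ j))))"

definition control_box :: "'r::finite controls set" where
  "control_box = {w. \<forall>i. 0 \<le> w $ i \<and> w $ i \<le> 1}"

text \<open>
  Only the values on \<open>UNIV \<times> control_box\<close> are constrained. Differentiability in the control
  is one-sided on the boundary of the box.
\<close>

definition regular_junction_map ::
    "(('c::finite, 'r::finite) densities \<Rightarrow> 'r controls \<Rightarrow> 'r fluxes) \<Rightarrow> bool" where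
  "regular_junction_map \<phi> \<longleftrightarrow>
     (\<exists>L. L-lipschitz_on (UNIV \<times> control_box) (\<lambda>(\<rho>, w). \<phi> \<rho> w)) \<and>
     (\<forall>\<rho>. \<exists>D :: 'r controls \<Rightarrow> ('r controls \<Rightarrow>\<^sub>L 'r fluxes).
        (\<forall>w\<in>control_box. (\<phi> \<rho> has_derivative blinfun_apply (D w)) (at w within control_box)) \<and>
        continuous_on control_box D)"

text \<open>
  Elements of \<open>L\<^sup>\<infinity>([0,T],[0,1]\<^sup>r)\<close> are handled through their representatives; everything
  below depends only on the class of the control modulo equality almost everywhere.
\<close>

definition admissible_controls :: "real \<Rightarrow> (real \<Rightarrow> 'r::finite controls) set" where
  "admissible_controls T =
     {u. u \<in> borel_measurable (lebesgue_on {0..T}) \<and>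
         (AE t in lebesgue_on {0..T}. u t \<in> control_box)}"

text \<open>
  Since controls are merely measurable in time, solutions are understood in the sense of
  Caratheodory.
\<close>

definition is_solution ::
    "real \<Rightarrow> ('r \<Rightarrow> 'c \<Rightarrow> real) \<Rightarrow> (('c, 'r) densities \<Rightarrow> 'r controls \<Rightarrow> 'r fluxes)
       \<Rightarrow> ('c, 'r) densities \<Rightarrow> (real \<Rightarrow> 'r controls)
       \<Rightarrow> (real \<Rightarrow> ('c::{finite,linorder}, 'r::finite) densities) \<Rightarrow> bool" where
  "is_solution T \<Delta>x \<phi> \<rho>0 u \<rho> \<longleftrightarrow>
     continuous_on {0..T} \<rho> \<and>
     set_integrable lebesgue {0..T} (\<lambda>s. fv_field \<Delta>x (\<rho> s) (\<phi> (\<rho> s) (u s))) \<and>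
     (\<forall>t\<in>{0..T}. \<rho> t = \<rho>0 + (LINT s:{0..t}|lebesgue. fv_field \<Delta>x (\<rho> s) (\<phi> (\<rho> s) (u s))))"

text \<open>
  For a regular junction map, positive cell lengths and an admissible control, a solution
  exists on the whole of \<open>[0,T]\<close> and is unique there: the numerical flux is locally Lipschitz
  and monotone (nondecreasing in its first and nonincreasing in its second argument), whence
  \<open>\<Sum>i j. \<Delta>x i j * \<bar>\<rho> t $ i $ j\<bar>\<close> grows at most at the rate given by the boundary fluxes,
  which are of linear growth. The choice operator is used because the values of
  \<open>\<rho>\<close> outside \<open>[0,T]\<close> are arbitrary.
\<close>

definition density_solution ::
    "real \<Rightarrow> ('r \<Rightarrow> 'c \<Rightarrow> real) \<Rightarrow> (('c, 'r) densities \<Rightarrow> 'r controls \<Rightarrow> 'r fluxes)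
       \<Rightarrow> ('c, 'r) densities \<Rightarrow> (real \<Rightarrow> 'r controls)
       \<Rightarrow> real \<Rightarrow> ('c::{finite,linorder}, 'r::finite) densities" where
  "density_solution T \<Delta>x \<phi> \<rho>0 u = (SOME \<rho>. is_solution T \<Delta>x \<phi> \<rho>0 u \<rho>)"

text \<open>Test functions on \<open>(0,T)\<close> are extended by zero to the real line.\<close>

definition TV_test_functions :: "real \<Rightarrow> (real \<Rightarrow> real) set" where
  "TV_test_functions T =
     {\<psi>. \<psi> C1_differentiable_on {0<..<T} \<and> closure {t. \<psi> t \<noteq> 0} \<subseteq> {0<..<T} \<and> (\<forall>t. \<bar>\<psi> t\<bar> \<le> 1)}"

definition TV :: "real \<Rightarrow> (real \<Rightarrow> real) \<Rightarrow> ereal" where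
  "TV T f = (SUP \<psi>\<in>TV_test_functions T. ereal (LINT t:{0..T}|lebesgue. f t * deriv \<psi> t))"

definition cost_C ::
    "real \<Rightarrow> ('r \<Rightarrow> 'c \<Rightarrow> real) \<Rightarrow> (('c, 'r) densities \<Rightarrow> 'r controls \<Rightarrow> 'r fluxes)
       \<Rightarrow> ('c::{finite,linorder}, 'r::finite) densities \<Rightarrow> 'r set \<Rightarrow> (real \<Rightarrow> 'r controls) \<Rightarrow> real" where
  "cost_C T \<Delta>x \<phi> \<rho>0 \<chi>path u = (\<Sum>i\<in>\<chi>path. \<Sum>j\<in>UNIV. density_solution T \<Delta>x \<phi> \<rho>0 u T $ i $ j)"

definition cost_S :: "real \<Rightarrow> nat \<Rightarrow> (real \<Rightarrow> 'r::finite controls) \<Rightarrow> real" where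
  "cost_S T Nmax u = (LINT t:{0..T}|lebesgue. (max ((\<Sum>i\<in>UNIV. u t $ i) - real Nmax) 0)\<^sup>2)"

definition cost_B :: "real \<Rightarrow> (real \<Rightarrow> 'r::finite controls) \<Rightarrow> ereal" where
  "cost_B T u = (\<Sum>i\<in>UNIV. TV T (\<lambda>t. u t $ i))"

definition cost_J ::
    "real \<Rightarrow> ('r \<Rightarrow> 'c \<Rightarrow> real) \<Rightarrow> (('c, 'r) densities \<Rightarrow> 'r controls \<Rightarrow> 'r fluxes)
       \<Rightarrow> ('c::{finite,linorder}, 'r::finite) densities \<Rightarrow> 'r set \<Rightarrow> nat \<Rightarrow> real \<Rightarrow> real
       \<Rightarrow> (real \<Rightarrow> 'r controls) \<Rightarrow> ereal" where
  "cost_J T \<Delta>x \<phi> \<rho>0 \<chi>path Nmax \<theta>S \<theta>B u =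
     ereal (cost_C T \<Delta>x \<phi> \<rho>0 \<chi>path u) + ereal (\<theta>S / 2 * cost_S T Nmax u)
       + ereal \<theta>B * cost_B T u"

end

theory Submission
  imports Defs "HOL-Complex_Analysis.Great_Picard"
begin

text \<open>
  The proof is the direct method of the calculus of variations. Since \<open>\<theta>B > 0\<close> and the rest of the
  cost is bounded below, the controls of a minimizing sequence have uniformly bounded total
  variation. Such a sequence has a subsequence that converges almost everywhere
  (\<open>TV_bounded_compact\<close>). The cost \<open>S\<close> and the final density are continuous along it, the total
  variation is lower semicontinuous (\<open>TV_lower_semicontinuous\<close>), and the limit is a minimizer.

  The compactness is proved directly from the definition of the total variation by duality. The
  primitives of the controls are equi-Lipschitz and therefore have a uniformly convergent
  subsequence, by the Arzela-Ascoli theorem. Uniform convergence of primitives improves to \<open>L\<^sup>1\<close>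
  convergence of the functions by the interpolation inequality \<open>L1_interpolation\<close>, in which the
  sign of the difference of two controls, corrected by its averages over a fine grid, is used as
  the derivative of a test function.

  The final density is a continuous function of the control because the controlled system is
  well-posed (\<open>density_solution_bounded_stable\<close>). The numerical flux is only locally Lipschitz and
  grows quadratically, so global existence rests on an a priori bound. It comes from the sign
  condition \<open>num_flux_dissipative\<close>: in the evolution of \<open>\<Sum>i j. \<Delta>x i j * \<bar>\<rho> $ i $ j\<bar>\<close> the fluxes between
  neighbouring cells can be discarded (\<open>fv_field_dissipation\<close>), and the boundary fluxes grow at most
  linearly, so Gronwall's inequality applies. The bound holds for the systems with truncated
  densities as well, uniformly in the truncation level. The truncated systems are globally
  Lipschitz in the density and are solved by Picard iteration (\<open>caratheodory_existence\<close>); beyond the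
  a priori bound the truncation has no effect. Stability with respect to the control is again
  Gronwall's inequality.
\<close>

section \<open>Integration of bounded measurable functions on an interval\<close>

lemma bounded_measurable_absolutely_integrable:
  fixes f :: "real \<Rightarrow> 'a::euclidean_space"
  assumes "f \<in> borel_measurable (lebesgue_on {a..b})"
    and "\<And>t. t \<in> {a..b} \<Longrightarrow> norm (f t) \<le> K"
  shows "f absolutely_integrable_on {a..b}"
  by (rule measurable_bounded_by_integrable_imp_absolutely_integrable[where g="\<lambda>_. K"])
     (use assms in auto)

lemma bounded_measurable_integrable:
  fixes f :: "real \<Rightarrow> 'a::euclidean_space"
  assumes "f \<in> borel_measurable (lebesgue_on {a..b})"
    and "\<And>t. t \<in> {a..b} \<Longrightarrow> norm (f t) \<le> K"
  shows "f integrable_on {a..b}"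
  using bounded_measurable_absolutely_integrable[OF assms]
  by (simp add: set_lebesgue_integral_eq_integral(1))

lemma borel_measurable_lebesgue_on_subinterval:
  assumes "f \<in> borel_measurable (lebesgue_on {a..b::real})" "{c..d} \<subseteq> {a..b}"
  shows "f \<in> borel_measurable (lebesgue_on {c..d})"
  using assms by (rule measurable_restrict_mono)

lemma bounded_convergence_ae:
  fixes f :: "nat \<Rightarrow> real \<Rightarrow> 'a::euclidean_space"
  assumes f: "\<And>n. f n \<in> borel_measurable (lebesgue_on {a..b})"
    and K: "\<And>n t. t \<in> {a..b} \<Longrightarrow> norm (f n t) \<le> K"
    and N: "negligible N"
    and lim: "\<And>t. t \<in> {a..b} - N \<Longrightarrow> (\<lambda>n. f n t) \<longlonglongrightarrow> g t"
  shows "(\<lambda>n. integral {a..b} (f n)) \<longlonglongrightarrow> integral {a..b} g"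
proof -
  define f' where "f' n t = (if t \<in> N then 0 else f n t)" for n t
  define g' where "g' t = (if t \<in> N then 0 else g t)" for t
  have eqf: "integral {a..b} (f' n) = integral {a..b} (f n)" for n
    by (rule integral_spike[OF N]) (auto simp: f'_def)
  have eqg: "integral {a..b} g' = integral {a..b} g"
    by (rule integral_spike[OF N]) (auto simp: g'_def)
  have "(\<lambda>n. integral {a..b} (f' n)) \<longlonglongrightarrow> integral {a..b} g'"
  proof (rule dominated_convergence(2)[where h="\<lambda>_. max K 0"])
    fix n
    show "f' n integrable_on {a..b}"
      by (rule integrable_spike[OF bounded_measurable_integrable[OF f K] N])
         (auto simp: f'_def)
  next
    fix n t assume "t \<in> {a..b}"
    with K[of t n] show "norm (f' n t) \<le> max K 0" by (auto simp: f'_def)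
  next
    fix t assume "t \<in> {a..b}"
    with lim show "(\<lambda>n. f' n t) \<longlonglongrightarrow> g' t" by (auto simp: f'_def g'_def)
  qed auto
  then show ?thesis by (simp add: eqf eqg)
qed

text \<open>
  A Lebesgue measurable function is an almost everywhere limit of continuous functions;
  cutting these off at the bound \<open>K\<close> of \<open>g\<close> makes the convergence dominated. This is the only
  density result that is needed below.
\<close>

lemma bounded_measurable_approx_continuous:
  fixes g :: "real \<Rightarrow> real"
  assumes g: "g \<in> borel_measurable (lebesgue_on {a..b})"
    and K: "\<And>t. t \<in> {a..b} \<Longrightarrow> \<bar>g t\<bar> \<le> K" and "0 \<le> K"
  obtains N h where "negligible N" "\<And>n::nat. continuous_on UNIV (h n)"
    "\<And>n t. \<bar>h n t\<bar> \<le> K" "\<And>t. t \<in> {a..b} - N \<Longrightarrow> (\<lambda>n. h n t) \<longlonglongrightarrow> g t"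
proof -
  have "g measurable_on {a..b}"
    using g by (subst measurable_on_iff_borel_measurable) auto
  then obtain N h where N: "negligible N" and h: "\<And>n. continuous_on UNIV (h n)"
    and lim: "\<And>x. x \<notin> N \<Longrightarrow> (\<lambda>n. h n x) \<longlonglongrightarrow> (if x \<in> {a..b} then g x else 0)"
    unfolding measurable_on_def by blast
  show thesis
  proof (rule that[of N "\<lambda>n t. max (-K) (min K (h n t))"])
    fix t assume t: "t \<in> {a..b} - N"
    have "(\<lambda>n. max (-K) (min K (h n t))) \<longlonglongrightarrow> max (-K) (min K (g t))"
      using lim[of t] t by (intro tendsto_intros) auto
    also have "max (-K) (min K (g t)) = g t" using K[of t] t by auto
    finally show "(\<lambda>n. max (-K) (min K (h n t))) \<longlonglongrightarrow> g t" .
  qed (use N h \<open>0 \<le> K\<close> in \<open>auto intro!: continuous_intros\<close>)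
qed

section \<open>Gronwall's inequality and chain rules for primitives of bounded functions\<close>

lemma gronwall:
  fixes w :: "real \<Rightarrow> real"
  assumes w: "continuous_on {0..T} w" and b: "0 \<le> b"
    and le: "\<And>t. t \<in> {0..T} \<Longrightarrow> w t \<le> a + b * integral {0..t} w"
    and t: "t \<in> {0..T}"
  shows "w t \<le> a * exp (b * t)"
proof -
  define v where "v t = a + b * integral {0..t} w" for t
  define z where "z s = v s * exp (- b * s)" for s
  have dz: "(z has_real_derivative (b * (w s - v s)) * exp (- b * s)) (at s within {0..T})"
    if "s \<in> {0..T}" for s
    unfolding z_def v_def
    by (auto intro!: derivative_eq_intros integral_has_real_derivative[OF w that] simp: algebra_simps)
  have "z t \<le> z 0"
  proof (rule DERIV_nonpos_imp_decreasing_open[where f=z and a=0 and b=t])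
    fix s assume s: "0 < s" "s < t"
    then have "at s within {0..T} = at s" using t by (intro at_within_Icc_at) auto
    moreover have "b * (w s - v s) * exp (- b * s) \<le> 0"
      using le[of s] s t b by (auto simp: v_def mult_le_0_iff)
    ultimately show "\<exists>y. (z has_real_derivative y) (at s) \<and> y \<le> 0"
      using dz[of s] s t by auto
  next
    have "continuous_on {0..T} z"
      using dz by (meson DERIV_continuous continuous_on_eq_continuous_within)
    then show "continuous_on {0..t} z" by (rule continuous_on_subset) (use t in auto)
  qed (use t in auto)
  then have "v t * exp (- b * t) \<le> a" by (simp add: z_def v_def)
  then have "v t * exp (- b * t) * exp (b * t) \<le> a * exp (b * t)"
    by (intro mult_right_mono) auto
  then have "v t \<le> a * exp (b * t)" by (simp add: exp_minus field_simps)
  with le[OF t] show ?thesis by (simp add: v_def)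
qed

text \<open>
  The chain rule for the composition of a \<open>C\<^sup>1\<close> function with a primitive of a bounded measurable
  function. For continuous densities it is the fundamental theorem of calculus, and both sides
  pass to the limit along a continuous approximation of \<open>g\<close>.
\<close>

lemma chain_rule_bounded_density:
  fixes g \<eta> \<eta>' :: "real \<Rightarrow> real"
  assumes g: "g \<in> borel_measurable (lebesgue_on {0..t})"
    and K: "\<And>s. s \<in> {0..t} \<Longrightarrow> \<bar>g s\<bar> \<le> K"
    and x: "\<And>s. s \<in> {0..t} \<Longrightarrow> x s = x0 + integral {0..s} g"
    and d: "\<And>r. (\<eta> has_real_derivative \<eta>' r) (at r)"
    and c: "continuous_on UNIV \<eta>'"
    and t: "0 \<le> t"
  shows "\<eta> (x t) = \<eta> x0 + integral {0..t} (\<lambda>s. \<eta>' (x s) * g s)"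
proof -
  have K0: "0 \<le> K" using K[of 0] t by force
  obtain N h where N: "negligible N" and h: "\<And>n::nat. continuous_on UNIV (h n)"
    and hK: "\<And>n s. \<bar>h n s\<bar> \<le> K" and lim: "\<And>s. s \<in> {0..t} - N \<Longrightarrow> (\<lambda>n. h n s) \<longlonglongrightarrow> g s"
    using bounded_measurable_approx_continuous[OF g K K0] by metis
  define y where "y n s = x0 + integral {0..s} (h n)" for n s
  have hc: "continuous_on {0..t} (h n)" for n using h by (rule continuous_on_subset) auto
  have hm: "h n \<in> borel_measurable (lebesgue_on {0..s})" for n s
    by (intro continuous_imp_measurable_on_sets_lebesgue continuous_on_subset[OF h]) auto
  have dy: "(y n has_real_derivative h n s) (at s within {0..t})" if "s \<in> {0..t}" for n s
    unfolding y_def by (auto intro!: derivative_eq_intros integral_has_real_derivative[OF hc that])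
  have yc: "continuous_on {0..t} (y n)" for n
    using dy by (meson DERIV_continuous continuous_on_eq_continuous_within)
  have ylim: "(\<lambda>n. y n s) \<longlonglongrightarrow> x s" if s: "s \<in> {0..t}" for s
    unfolding y_def x[OF s]
    by (intro tendsto_intros bounded_convergence_ae[where K=K and N=N])
       (use s hm hK N lim in auto)
  have yb: "y n s \<in> {x0 - K*t..x0 + K*t}" if s: "s \<in> {0..t}" for n s
  proof -
    have "norm (integral {0..s} (h n)) \<le> integral {0..s} (\<lambda>_. K)"
      using hK by (intro integral_norm_bound_integral bounded_measurable_integrable[OF hm]) auto
    also have "\<dots> = K * s" using s by simp
    also have "\<dots> \<le> K * t" using s K0 by (simp add: mult_left_mono)
    finally show ?thesis by (auto simp: y_def abs_le_iff)
  qed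
  have "compact (\<eta>' ` {x0 - K*t..x0 + K*t})"
    by (intro compact_continuous_image continuous_on_subset[OF c]) auto
  then obtain E where E: "\<And>r. r \<in> {x0 - K*t..x0 + K*t} \<Longrightarrow> norm (\<eta>' r) \<le> E"
    using compact_imp_bounded[of "\<eta>' ` {x0 - K*t..x0 + K*t}"] unfolding bounded_iff by blast
  have E0: "0 \<le> E" using E[OF yb[of 0]] t norm_ge_zero order_trans by force
  have eq: "integral {0..t} (\<lambda>s. \<eta>' (y n s) * h n s) = \<eta> (y n t) - \<eta> x0" for n
  proof -
    have "((\<lambda>s. \<eta>' (y n s) * h n s) has_integral \<eta> (y n t) - \<eta> (y n 0)) {0..t}"
    proof (rule fundamental_theorem_of_calculus[OF t])
      fix s assume "s \<in> {0..t}"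
      then have "((\<lambda>s. \<eta> (y n s)) has_real_derivative \<eta>' (y n s) * h n s) (at s within {0..t})"
        by (intro DERIV_chain2[OF d dy])
      then show "((\<lambda>s. \<eta> (y n s)) has_vector_derivative \<eta>' (y n s) * h n s) (at s within {0..t})"
        by (simp add: has_real_derivative_iff_has_vector_derivative)
    qed
    then show ?thesis by (simp add: integral_unique y_def)
  qed
  have "(\<lambda>n. integral {0..t} (\<lambda>s. \<eta>' (y n s) * h n s)) \<longlonglongrightarrow> integral {0..t} (\<lambda>s. \<eta>' (x s) * g s)"
  proof (rule bounded_convergence_ae[where K="E*K" and N=N])
    fix n
    show "(\<lambda>s. \<eta>' (y n s) * h n s) \<in> borel_measurable (lebesgue_on {0..t})"
      by (intro continuous_imp_measurable_on_sets_lebesgue continuous_intros hc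
            continuous_on_compose2[OF c yc]) auto
  next
    fix n s assume "s \<in> {0..t}"
    then show "norm (\<eta>' (y n s) * h n s) \<le> E * K"
      using E[OF yb] hK E0 by (auto simp: abs_mult intro!: mult_mono)
  next
    fix s assume s: "s \<in> {0..t} - N"
    have "isCont \<eta>' (x s)" using c by (simp add: continuous_on_eq_continuous_at)
    then show "(\<lambda>n. \<eta>' (y n s) * h n s) \<longlonglongrightarrow> \<eta>' (x s) * g s"
      using s by (intro tendsto_mult lim isCont_tendsto_compose[OF _ ylim]) auto
  qed (rule N)
  moreover have "(\<lambda>n. \<eta> (y n t) - \<eta> x0) \<longlonglongrightarrow> \<eta> (x t) - \<eta> x0"
    using t by (intro tendsto_intros isCont_tendsto_compose[OF DERIV_isCont[OF d] ylim]) auto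
  ultimately have "integral {0..t} (\<lambda>s. \<eta>' (x s) * g s) = \<eta> (x t) - \<eta> x0"
    unfolding eq by (rule LIMSEQ_unique)
  then show ?thesis by simp
qed

text \<open>
  The case \<open>\<eta> = \<bar>\<cdot>\<bar>\<close>, obtained from \<open>\<eta>\<^sub>n r = sqrt (r\<^sup>2 + \<epsilon>\<^sub>n\<^sup>2)\<close> as \<open>\<epsilon>\<^sub>n\<close> tends to \<open>0\<close>. The derivatives of
  \<open>\<eta>\<^sub>n\<close> are bounded by \<open>1\<close> and tend to \<open>sgn\<close> at every point, including \<open>0\<close>, so the zeros of \<open>x\<close> need
  no special treatment.
\<close>

lemma abs_chain_rule:
  fixes g :: "real \<Rightarrow> real"
  assumes g: "g \<in> borel_measurable (lebesgue_on {0..t})"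
    and K: "\<And>s. s \<in> {0..t} \<Longrightarrow> \<bar>g s\<bar> \<le> K"
    and x: "\<And>s. s \<in> {0..t} \<Longrightarrow> x s = x0 + integral {0..s} g"
    and t: "0 \<le> t"
  shows "\<bar>x t\<bar> = \<bar>x0\<bar> + integral {0..t} (\<lambda>s. sgn (x s) * g s)"
proof -
  define e where "e n = inverse (real (Suc n))" for n
  have e0: "e n > 0" for n by (simp add: e_def)
  have elim: "e \<longlonglongrightarrow> 0" unfolding e_def by (rule LIMSEQ_inverse_real_of_nat)
  define \<eta> where "\<eta> n r = sqrt (r\<^sup>2 + (e n)\<^sup>2)" for n r
  define \<eta>' where "\<eta>' n r = r / sqrt (r\<^sup>2 + (e n)\<^sup>2)" for n r
  have pos: "r\<^sup>2 + (e n)\<^sup>2 > 0" for n r using e0[of n] by (simp add: add_nonneg_pos)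
  have d: "(\<eta> n has_real_derivative \<eta>' n r) (at r)" for n r
    unfolding \<eta>_def \<eta>'_def using pos[of r n]
    by (auto intro!: derivative_eq_intros simp: field_simps)
  have c: "continuous_on UNIV (\<eta>' n)" for n
    unfolding \<eta>'_def using pos[of _ n] by (auto intro!: continuous_intros simp: less_le)
  have b: "\<bar>\<eta>' n r\<bar> \<le> 1" for n r
  proof -
    have "\<bar>r\<bar> \<le> sqrt (r\<^sup>2 + (e n)\<^sup>2)" by (rule real_le_rsqrt) simp
    then show ?thesis unfolding \<eta>'_def using pos[of r n] by (simp add: abs_divide)
  qed
  have lim: "(\<lambda>n. \<eta> n r) \<longlonglongrightarrow> \<bar>r\<bar>" for r
  proof -
    have "(\<lambda>n. \<eta> n r) \<longlonglongrightarrow> sqrt (r\<^sup>2 + 0\<^sup>2)"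
      unfolding \<eta>_def by (intro tendsto_intros elim)
    then show ?thesis by simp
  qed
  have lim': "(\<lambda>n. \<eta>' n r) \<longlonglongrightarrow> sgn r" for r
  proof (cases "r = 0")
    case False
    have "(\<lambda>n. r / \<eta> n r) \<longlonglongrightarrow> r / \<bar>r\<bar>"
      using False by (intro tendsto_intros lim) auto
    moreover have "r / \<bar>r\<bar> = sgn r" using False by (auto simp: sgn_real_def)
    ultimately show ?thesis by (simp add: \<eta>'_def \<eta>_def)
  qed (simp add: \<eta>'_def)
  have gi: "g integrable_on {0..t}" using bounded_measurable_integrable[OF g] K by auto
  have xc: "continuous_on {0..t} x"
    by (rule continuous_on_eq[of _ "\<lambda>s. x0 + integral {0..s} g"])
       (auto intro!: continuous_intros indefinite_integral_continuous_1 gi simp: x)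
  have eq: "integral {0..t} (\<lambda>s. \<eta>' n (x s) * g s) = \<eta> n (x t) - \<eta> n x0" for n
    using chain_rule_bounded_density[OF g K x d c t, where n1=n] by simp
  have "(\<lambda>n. integral {0..t} (\<lambda>s. \<eta>' n (x s) * g s)) \<longlonglongrightarrow> integral {0..t} (\<lambda>s. sgn (x s) * g s)"
  proof (rule bounded_convergence_ae[where K=K and N="{}"])
    fix n
    show "(\<lambda>s. \<eta>' n (x s) * g s) \<in> borel_measurable (lebesgue_on {0..t})"
      by (intro borel_measurable_times g continuous_imp_measurable_on_sets_lebesgue
            continuous_on_compose2[OF c xc]) auto
  next
    fix n s assume s: "s \<in> {0..t}"
    have "\<bar>\<eta>' n (x s)\<bar> * \<bar>g s\<bar> \<le> 1 * K" using K[OF s] b by (intro mult_mono) auto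
    then show "norm (\<eta>' n (x s) * g s) \<le> K" by (simp add: abs_mult)
  qed (auto intro!: tendsto_intros lim')
  moreover have "(\<lambda>n. \<eta> n (x t) - \<eta> n x0) \<longlonglongrightarrow> \<bar>x t\<bar> - \<bar>x0\<bar>"
    by (intro tendsto_intros lim)
  ultimately have "integral {0..t} (\<lambda>s. sgn (x s) * g s) = \<bar>x t\<bar> - \<bar>x0\<bar>"
    unfolding eq by (rule LIMSEQ_unique)
  then show ?thesis by simp
qed

section \<open>Functions of bounded variation, by duality\<close>

text \<open>
  The definition of \<open>TV\<close>, restated in terms of the derivative of the test function: \<open>k\<close> is continuous
  with compact support and zero mean, and \<open>integral {0..t} k / M\<close> is the test function.
\<close>

lemma TV_test_bound:
  fixes f k :: "real \<Rightarrow> real"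
  assumes f: "f \<in> borel_measurable (lebesgue_on {0..T})"
    and F: "\<And>t. t \<in> {0..T} \<Longrightarrow> \<bar>f t\<bar> \<le> F"
    and V: "TV T f \<le> ereal V"
    and k: "continuous_on UNIV k" and ab: "0 < a" "a \<le> b" "b < T"
    and supp: "\<And>t. t \<notin> {a..b} \<Longrightarrow> k t = 0"
    and zero: "integral {0..T} k = 0"
    and M: "\<And>t. t \<in> {0..T} \<Longrightarrow> \<bar>integral {0..t} k\<bar> \<le> M" and M0: "0 < M"
  shows "integral {0..T} (\<lambda>t. f t * k t) \<le> M * V"
proof -
  define \<psi> where "\<psi> t = integral {0..t} k / M" for t
  have kc: "continuous_on S k" for S using k by (rule continuous_on_subset) auto
  have ki: "k integrable_on {c..d}" for c d by (intro integrable_continuous_real kc)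
  have d: "(\<psi> has_real_derivative k t / M) (at t)" if t: "t \<in> {0<..<T}" for t
  proof -
    have "(\<psi> has_real_derivative k t / M) (at t within {0..T})"
      unfolding \<psi>_def using t M0
      by (auto intro!: derivative_eq_intros integral_has_real_derivative[where a=0 and b=T] kc)
    then show ?thesis using t by (simp add: at_within_Icc_at)
  qed
  have vanish: "\<psi> t = 0" if "t \<notin> {a..b}" for t
  proof (cases "t < a")
    case True
    then have "integral {0..t} k = integral {0..t} (\<lambda>_. 0)"
      by (intro integral_cong supp) auto
    then show ?thesis by (simp add: \<psi>_def)
  next
    case False
    with that have t: "b < t" by auto
    have *: "integral {0..s} k = integral {0..b} k" if s: "b < s" for s
    proof -
      have "integral {0..b} k + integral {b..s} k = integral {0..s} k"
        using ab s by (intro Henstock_Kurzweil_Integration.integral_combine ki) auto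
      moreover have "integral {b..s} k = integral {b..s} (\<lambda>_. 0)"
        by (rule integral_spike[of "{b}"]) (auto simp: supp)
      ultimately show ?thesis by simp
    qed
    show ?thesis using *[OF t] *[of T] ab zero by (simp add: \<psi>_def)
  qed
  have "\<psi> \<in> TV_test_functions T"
    unfolding TV_test_functions_def
  proof (intro CollectI conjI allI)
    show "\<psi> C1_differentiable_on {0<..<T}"
      unfolding C1_differentiable_on_def
      using d M0 by (intro exI[of _ "\<lambda>t. k t / M"])
        (auto simp: has_real_derivative_iff_has_vector_derivative intro!: continuous_intros kc)
    have "closure {t. \<psi> t \<noteq> 0} \<subseteq> {a..b}"
      by (intro closure_minimal subsetI) (use vanish in blast, simp)
    then show "closure {t. \<psi> t \<noteq> 0} \<subseteq> {0<..<T}" using ab by auto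
    show "\<bar>\<psi> t\<bar> \<le> 1" for t
    proof (cases "t \<in> {0..T}")
      case True
      with M[OF True] M0 show ?thesis by (simp add: \<psi>_def abs_divide)
    next
      case False
      with ab have "t \<notin> {a..b}" by auto
      then show ?thesis by (simp add: vanish)
    qed
  qed
  then have "ereal (LINT t:{0..T}|lebesgue. f t * deriv \<psi> t) \<le> TV T f"
    unfolding TV_def by (rule SUP_upper)
  with V have le: "(LINT t:{0..T}|lebesgue. f t * deriv \<psi> t) \<le> V"
    using order_trans by fastforce
  have "bounded (k ` {0..T})"
    by (intro compact_imp_bounded compact_continuous_image kc) auto
  then obtain B where B: "\<And>t. t \<in> {0..T} \<Longrightarrow> norm (k t) \<le> B"
    unfolding bounded_iff by blast
  have fk: "(\<lambda>t. f t * k t / M) absolutely_integrable_on {0..T}"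
  proof (rule bounded_measurable_absolutely_integrable[where K="F * B / M"])
    show "(\<lambda>t. f t * k t / M) \<in> borel_measurable (lebesgue_on {0..T})"
      by (intro borel_measurable_times borel_measurable_divide f
           continuous_imp_measurable_on_sets_lebesgue kc) auto
    fix t assume t: "t \<in> {0..T}"
    have "\<bar>f t\<bar> * \<bar>k t\<bar> \<le> F * B"
      using F[OF t] B[OF t] by (intro mult_mono) auto
    then show "norm (f t * k t / M) \<le> F * B / M"
      using M0 by (simp add: abs_mult abs_divide divide_right_mono)
  qed
  have eq: "f t * deriv \<psi> t = f t * k t / M" if "t \<in> {0..T} - {0,T}" for t
    using d[of t] that by (auto simp: DERIV_imp_deriv)
  have ai: "(\<lambda>t. f t * deriv \<psi> t) absolutely_integrable_on {0..T}"
    by (rule absolutely_integrable_spike[OF fk, of "{0,T}"]) (use eq in auto)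
  have "(LINT t:{0..T}|lebesgue. f t * deriv \<psi> t) = integral {0..T} (\<lambda>t. f t * deriv \<psi> t)"
    using ai by (rule set_lebesgue_integral_eq_integral)
  also have "\<dots> = integral {0..T} (\<lambda>t. f t * k t / M)"
    by (rule integral_spike[of "{0,T}"]) (use eq in auto)
  also have "\<dots> = integral {0..T} (\<lambda>t. f t * k t) / M" by simp
  finally show ?thesis using mult_left_mono[OF le, of M] M0 by simp
qed

text \<open>
  The same bound for a merely bounded measurable \<open>g\<close> of zero mean, whose primitive is bounded by
  \<open>M\<close>. It extends the class of test functions to Lipschitz functions vanishing at the end points,
  which makes it possible to test with sign functions.
\<close>

lemma TV_dual_bound:
  fixes f g :: "real \<Rightarrow> real"
  assumes T: "0 < T"
    and f: "f \<in> borel_measurable (lebesgue_on {0..T})"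
    and F: "\<And>t. t \<in> {0..T} \<Longrightarrow> \<bar>f t\<bar> \<le> F"
    and V: "TV T f \<le> ereal V"
    and g: "g \<in> borel_measurable (lebesgue_on {0..T})"
    and K: "\<And>t. t \<in> {0..T} \<Longrightarrow> \<bar>g t\<bar> \<le> K"
    and zero: "integral {0..T} g = 0"
    and M: "\<And>t. t \<in> {0..T} \<Longrightarrow> \<bar>integral {0..t} g\<bar> \<le> M"
  shows "integral {0..T} (\<lambda>t. f t * g t) \<le> M * V"
proof -
  have K0: "0 \<le> K" using K[of 0] T by force
  have F0: "0 \<le> F" using F[of 0] T by force
  have M0: "0 \<le> M" using M[of 0] T by force
  obtain N h where N: "negligible N" and h: "\<And>n::nat. continuous_on UNIV (h n)"
    and hK: "\<And>n s. \<bar>h n s\<bar> \<le> K" and lim: "\<And>s. s \<in> {0..T} - N \<Longrightarrow> (\<lambda>n. h n s) \<longlonglongrightarrow> g s"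
    using bounded_measurable_approx_continuous[OF g K K0] by metis
  \<comment> \<open>Continuous cutoffs, supported in \<open>[1/(n+1), T - 1/(n+1)]\<close> and increasing to \<open>1\<close> on \<open>(0,T)\<close>.\<close>
  define \<xi> where "\<xi> n t = max 0 (min 1 (real (Suc n) * min t (T - t) - 1))" for n t
  have \<xi>c: "continuous_on S (\<xi> n)" for S n unfolding \<xi>_def by (intro continuous_intros)
  have \<xi>01: "0 \<le> \<xi> n t" "\<xi> n t \<le> 1" for n t by (auto simp: \<xi>_def)
  have \<xi>0: "\<xi> n t = 0" if "t \<notin> {1 / Suc n..T - 1 / Suc n}" for n t
  proof -
    have "min t (T - t) < 1 / Suc n" using that by auto
    then have "real (Suc n) * min t (T - t) < 1"
      by (metis less_divide_eq mult.commute of_nat_0_less_iff zero_less_Suc)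
    then show ?thesis by (simp add: \<xi>_def)
  qed
  have \<xi>lim: "(\<lambda>n. \<xi> n t) \<longlonglongrightarrow> 1" if t: "t \<in> {0<..<T}" for t
  proof (rule tendsto_eventually)
    have m: "0 < min t (T - t)" using t by auto
    obtain n0 where n0: "2 / min t (T - t) < real n0" using reals_Archimedean2 by blast
    show "\<forall>\<^sub>F n in sequentially. \<xi> n t = 1"
      using eventually_ge_at_top[of n0]
    proof eventually_elim
      case (elim n)
      have "2 / min t (T - t) \<le> real (Suc n)" using n0 elim by linarith
      then have "2 \<le> real (Suc n) * min t (T - t)" using m by (simp only: divide_le_eq)
      then show ?case by (simp add: \<xi>_def)
    qed
  qed
  define N' where "N' = N \<union> {0, T}"
  have N': "negligible N'" using N by (auto simp: N'_def)
  have hm: "(\<lambda>t. \<xi> n t * h n t) \<in> borel_measurable (lebesgue_on {c..d})" for n c d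
    by (intro continuous_imp_measurable_on_sets_lebesgue continuous_intros \<xi>c
        continuous_on_subset[OF h]) auto
  have hb: "\<bar>\<xi> n t * h n t\<bar> \<le> K" for n t
    using mult_mono[OF \<xi>01(2) hK, of n t n t] \<xi>01[of n t] hK K0 by (simp add: abs_mult)
  define c where "c n = integral {0..T} (\<lambda>t. \<xi> n t * h n t)" for n
  define d where "d n = integral {0..T} (\<xi> n)" for n
  define q where "q n = c n / d n" for n
  have hlim: "(\<lambda>n. \<xi> n t * h n t) \<longlonglongrightarrow> g t" if "t \<in> {0..T} - N'" for t
    using tendsto_mult[OF \<xi>lim lim, of t t] that by (auto simp: N'_def)
  have clim: "c \<longlonglongrightarrow> 0"
  proof -
    have "c \<longlonglongrightarrow> integral {0..T} g"
      unfolding c_def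
      by (rule bounded_convergence_ae[where K=K and N=N']) (use hm hb N' hlim in auto)
    then show ?thesis by (simp add: zero)
  qed
  have dlim: "d \<longlonglongrightarrow> T"
  proof -
    have "d \<longlonglongrightarrow> integral {0..T} (\<lambda>_. 1)"
      unfolding d_def
      by (rule bounded_convergence_ae[where K=1 and N=N'])
         (use \<xi>01 N' \<xi>lim in \<open>auto simp: N'_def intro!: continuous_imp_measurable_on_sets_lebesgue \<xi>c\<close>)
    then show ?thesis using T by simp
  qed
  have qlim: "q \<longlonglongrightarrow> 0"
    using tendsto_divide[OF clim dlim] T by (simp add: q_def[abs_def])
  then have "Bseq q" by (intro convergent_imp_Bseq convergentI)
  then obtain Q where Q: "\<And>n. \<bar>q n\<bar> \<le> Q"
    unfolding Bseq_def real_norm_def by blast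
  \<comment> \<open>The multiple \<open>q n\<close> of the cutoff is subtracted to restore the zero mean that cutting off \<open>h n\<close>
     destroys.\<close>
  define k where "k n t = \<xi> n t * h n t - q n * \<xi> n t" for n t
  have kc: "continuous_on S (k n)" for n S
    unfolding k_def by (intro continuous_intros \<xi>c continuous_on_subset[OF h]) auto
  have km: "k n \<in> borel_measurable (lebesgue_on {c..d})" for n c d
    by (intro continuous_imp_measurable_on_sets_lebesgue kc) auto
  have kb: "\<bar>k n t\<bar> \<le> K + Q" for n t
  proof -
    have "\<bar>q n * \<xi> n t\<bar> \<le> Q * 1"
      unfolding abs_mult using \<xi>01[of n t] Q[of n] by (intro mult_mono) auto
    with hb[of n t] show ?thesis unfolding k_def by linarith
  qed
  have klim: "(\<lambda>n. k n t) \<longlonglongrightarrow> g t" if t: "t \<in> {0..T} - N'" for t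
  proof -
    have "(\<lambda>n. k n t) \<longlonglongrightarrow> g t - 0 * 1"
      unfolding k_def using t by (intro tendsto_intros hlim qlim \<xi>lim) (auto simp: N'_def)
    then show ?thesis by simp
  qed
  define e where "e n = integral {0..T} (\<lambda>t. \<bar>k n t - g t\<bar>)" for n
  have kgm: "(\<lambda>t. \<bar>k n t - g t\<bar>) \<in> borel_measurable (lebesgue_on {0..T})" for n
    by (intro borel_measurable_abs borel_measurable_diff km g)
  have kgb: "\<bar>k n t - g t\<bar> \<le> K + Q + K" if "t \<in> {0..T}" for n t
    using kb[of n t] K[OF that] by linarith
  have elim: "e \<longlonglongrightarrow> 0"
  proof -
    have "e \<longlonglongrightarrow> integral {0..T} (\<lambda>t::real. 0::real)"
      unfolding e_def
    proof (rule bounded_convergence_ae[where K="K+Q+K" and N=N'])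
      fix t assume "t \<in> {0..T} - N'"
      then show "(\<lambda>n. \<bar>k n t - g t\<bar>) \<longlonglongrightarrow> 0"
        using klim[of t] by (simp add: LIM_zero tendsto_rabs_zero)
    qed (use N' kgm kgb in auto)
    then show ?thesis by simp
  qed
  have kgi: "(\<lambda>s. \<bar>k n s - g s\<bar>) integrable_on {0..T}" for n
    using bounded_measurable_integrable[OF kgm] kgb by auto
  have e0: "0 \<le> e n" for n unfolding e_def by (intro integral_nonneg kgi) auto
  have prim: "\<bar>integral {0..t} (k n)\<bar> \<le> M + e n" if t: "t \<in> {0..T}" for n t
  proof -
    have gi: "g integrable_on {0..t}"
      by (rule bounded_measurable_integrable[OF borel_measurable_lebesgue_on_subinterval[OF g], where K=K])
         (use t K in auto)
    have ki: "k n integrable_on {0..t}" by (intro integrable_continuous_real kc)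
    have ai: "(\<lambda>s. \<bar>k n s - g s\<bar>) integrable_on {0..t}"
      using kgi by (rule integrable_on_subinterval) (use t in auto)
    have "\<bar>integral {0..t} (\<lambda>s. k n s - g s)\<bar> \<le> integral {0..t} (\<lambda>s. \<bar>k n s - g s\<bar>)"
      using integral_norm_bound_integral[OF integrable_diff[OF ki gi] ai] by simp
    also have "\<dots> \<le> e n"
      unfolding e_def using t by (intro integral_subset_le ai kgi) auto
    finally have "\<bar>integral {0..t} (k n) - integral {0..t} g\<bar> \<le> e n"
      by (simp add: integral_diff[OF ki gi])
    with M[OF t] show ?thesis by linarith
  qed
  \<comment> \<open>Only there to make the bound on the primitive strictly positive when \<open>M = 0\<close>.\<close>
  define \<delta> where "\<delta> n = inverse (real (Suc n))" for n
  have \<delta>0: "\<delta> n > 0" for n by (simp add: \<delta>_def)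
  have le: "\<forall>\<^sub>F n in sequentially. integral {0..T} (\<lambda>t. f t * k n t) \<le> (M + e n + \<delta> n) * V"
  proof -
    obtain n0 where n0: "2 / T < real n0" using reals_Archimedean2 by blast
    have "\<forall>\<^sub>F n in sequentially. d n > 0" using dlim T by (rule order_tendstoD(1))
    with eventually_ge_at_top[of n0] show ?thesis
    proof eventually_elim
      case (elim n)
      have "2 / T < Suc n" using n0 elim by linarith
      then have *: "2 / Suc n < T" using T by (simp add: field_simps)
      show ?case
      proof (rule TV_test_bound[OF f F V kc, of "1 / Suc n" "T - 1 / Suc n"])
        fix t assume "t \<notin> {1 / Suc n..T - 1 / Suc n}"
        then show "k n t = 0" by (simp add: k_def \<xi>0 del: of_nat_Suc)
      next
        have 1: "(\<lambda>t. \<xi> n t * h n t) integrable_on {0..T}"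
          using bounded_measurable_integrable[OF hm, of _ _ _ K] hb by auto
        have 2: "\<xi> n integrable_on {0..T}" by (intro integrable_continuous_real \<xi>c)
        have "integral {0..T} (k n) = c n - q n * d n"
          unfolding k_def c_def d_def
          by (subst integral_diff[OF 1]) (auto intro!: integrable_continuous_real continuous_intros \<xi>c)
        then show "integral {0..T} (k n) = 0" using elim by (simp add: q_def)
      next
        fix t assume "t \<in> {0..T}"
        then show "\<bar>integral {0..t} (k n)\<bar> \<le> M + e n + \<delta> n"
          using prim[of t n] \<delta>0[of n] by linarith
      next
        show "0 < M + e n + \<delta> n" using M0 e0[of n] \<delta>0[of n] by linarith
        show "1 / Suc n \<le> T - 1 / Suc n" using * by linarith
      qed auto
    qed
  qed
  have lim1: "(\<lambda>n. (M + e n + \<delta> n) * V) \<longlonglongrightarrow> (M + 0 + 0) * V"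
    unfolding \<delta>_def by (intro tendsto_intros elim LIMSEQ_inverse_real_of_nat)
  have lim2: "(\<lambda>n. integral {0..T} (\<lambda>t. f t * k n t)) \<longlonglongrightarrow> integral {0..T} (\<lambda>t. f t * g t)"
  proof (rule bounded_convergence_ae[where K="F*(K+Q)" and N=N'])
    fix n show "(\<lambda>t. f t * k n t) \<in> borel_measurable (lebesgue_on {0..T})"
      by (intro borel_measurable_times f km)
    fix t assume t: "t \<in> {0..T}"
    show "norm (f t * k n t) \<le> F * (K + Q)"
      unfolding real_norm_def abs_mult using F[OF t] kb[of n t] F0 by (intro mult_mono) auto
  next
    fix t assume "t \<in> {0..T} - N'"
    then show "(\<lambda>n. f t * k n t) \<longlonglongrightarrow> f t * g t" by (intro tendsto_mult tendsto_const klim)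
  qed (rule N')
  have "integral {0..T} (\<lambda>t. f t * g t) \<le> (M + 0 + 0) * V"
    using lim2 lim1 le[unfolded eventually_sequentially] by (rule LIMSEQ_le)
  then show ?thesis by simp
qed

section \<open>Compactness in the space of functions of bounded variation\<close>

lemma borel_measurable_vec_nth:
  fixes f :: "'a \<Rightarrow> real ^ 'n"
  assumes "f \<in> borel_measurable M"
  shows "(\<lambda>x. f x $ i) \<in> borel_measurable M"
  by (rule borel_measurable_continuous_on[where f="\<lambda>v. v $ i", OF _ assms]) (intro continuous_intros)

text \<open>
  An interpolation inequality: the \<open>L\<^sup>1\<close> norm of \<open>f1 - f2\<close> is controlled by the total variations and the
  sup norm of its primitive. The interval is divided into \<open>N\<close> cells of length \<open>h = T / N\<close>, and
  \<open>sgn (f1 - f2)\<close> is split into its cell averages \<open>P\<close> and the rest \<open>g\<close>. The primitive of \<open>g\<close> vanishes at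
  all nodes, hence is bounded by \<open>2 * h\<close>, and \<open>g\<close> is an admissible function in \<open>TV_dual_bound\<close>. The
  step function \<open>P\<close> only sees the increments of the primitive of \<open>f1 - f2\<close> over the cells.
\<close>

lemma L1_interpolation:
  fixes f1 f2 :: "real \<Rightarrow> real"
  assumes T: "0 < T" and N: "0 < (N::nat)"
    and f1: "f1 \<in> borel_measurable (lebesgue_on {0..T})"
    and f2: "f2 \<in> borel_measurable (lebesgue_on {0..T})"
    and F1: "\<And>t. t \<in> {0..T} \<Longrightarrow> \<bar>f1 t\<bar> \<le> F"
    and F2: "\<And>t. t \<in> {0..T} \<Longrightarrow> \<bar>f2 t\<bar> \<le> F"
    and V1: "TV T f1 \<le> ereal V" and V2: "TV T f2 \<le> ereal V"
    and E: "\<And>t. t \<in> {0..T} \<Longrightarrow> \<bar>integral {0..t} (\<lambda>s. f1 s - f2 s)\<bar> \<le> E"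
  shows "integral {0..T} (\<lambda>t. \<bar>f1 t - f2 t\<bar>) \<le> 4 * T / real N * V + 2 * real N * E"
proof -
  define h where "h = T / N"
  have h0: "0 < h" and Nh: "N * h = T" using T N by (auto simp: h_def)
  define d where "d t = f1 t - f2 t" for t
  have dm: "d \<in> borel_measurable (lebesgue_on {0..T})"
    unfolding d_def by (intro borel_measurable_diff f1 f2)
  have db: "\<bar>d t\<bar> \<le> 2 * F" if "t \<in> {0..T}" for t
    using F1[OF that] F2[OF that] unfolding d_def by linarith
  define g0 where "g0 t = sgn (d t)" for t
  have g0m: "g0 \<in> borel_measurable (lebesgue_on {0..T})"
    unfolding g0_def sgn_real_def using dm by measurable
  have g0b: "\<bar>g0 t\<bar> \<le> 1" for t by (simp add: g0_def sgn_real_def)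
  have g0i: "g0 integrable_on {a..b}" if "{a..b} \<subseteq> {0..T}" for a b
    using bounded_measurable_integrable[OF borel_measurable_lebesgue_on_subinterval[OF g0m that]] g0b
    by auto
  have g0int: "\<bar>integral {a..b} g0\<bar> \<le> b - a" if "{a..b} \<subseteq> {0..T}" "a \<le> b" for a b
    using integral_norm_bound_integral[OF g0i[OF that(1)], of "\<lambda>_. 1"] g0b that by auto
  have cell: "{real k * h..real (Suc k) * h} \<subseteq> {0..T}" if "k < N" for k
  proof -
    have "real (Suc k) * h \<le> N * h" using that h0 by (intro mult_right_mono) auto
    then show ?thesis using h0 Nh by auto
  qed
  define A where "A k = (if k < N then integral {real k * h..real (Suc k) * h} g0 / h else 0)" for k
  have Ab: "\<bar>A k\<bar> \<le> 1" for k
  proof (cases "k < N")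
    case True
    have "\<bar>integral {real k * h..real (Suc k) * h} g0\<bar> \<le> h"
      using g0int[OF cell[OF True]] h0 by (simp add: algebra_simps)
    then show ?thesis using True h0 by (simp add: A_def abs_divide)
  qed (simp add: A_def)
  define P where "P t = A (nat \<lfloor>t / h\<rfloor>)" for t :: real
  have Pb: "\<bar>P t\<bar> \<le> 1" for t unfolding P_def by (rule Ab)
  have "(\<lambda>t::real. \<lfloor>t / h\<rfloor>) \<in> measurable borel (count_space UNIV)"
    by measurable
  then have "P \<in> borel_measurable borel"
    using measurable_compose[of "\<lambda>t::real. \<lfloor>t / h\<rfloor>" borel "count_space UNIV" "\<lambda>z. A (nat z)" borel]
    by (simp add: P_def[abs_def])
  then have Pm: "P \<in> borel_measurable (lebesgue_on S)" for S
    by (intro measurable_restrict_space1 measurable_completion) simp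
  have Pcell: "P t = A k" if "real k * h \<le> t" "t < real (Suc k) * h" for t k
  proof -
    have "real k \<le> t / h" "t / h < real k + 1" using that h0 by (auto simp: field_simps)
    then have "\<lfloor>t / h\<rfloor> = int k" by linarith
    then show ?thesis by (simp add: P_def)
  qed
  define g where "g t = g0 t - P t" for t
  have gm: "g \<in> borel_measurable (lebesgue_on {0..T})"
    unfolding g_def by (intro borel_measurable_diff g0m Pm)
  have gb: "\<bar>g t\<bar> \<le> 2" for t using g0b[of t] Pb[of t] unfolding g_def by linarith
  have gi: "g integrable_on {a..b}" if "{a..b} \<subseteq> {0..T}" for a b
    using bounded_measurable_integrable[OF borel_measurable_lebesgue_on_subinterval[OF gm that]] gb
    by auto
  have dPm: "(\<lambda>t. d t * P t) \<in> borel_measurable (lebesgue_on {0..T})"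
    by (intro borel_measurable_times dm Pm)
  have dPb: "\<bar>d t * P t\<bar> \<le> 2 * F" if "t \<in> {0..T}" for t
    using mult_mono[OF db[OF that] Pb, of t] db[OF that] by (simp add: abs_mult)
  have dPi: "(\<lambda>t. d t * P t) integrable_on {a..b}" if "{a..b} \<subseteq> {0..T}" for a b
    using bounded_measurable_integrable[OF borel_measurable_lebesgue_on_subinterval[OF dPm that],
        of "2*F"] dPb that by auto
  have di: "d integrable_on {a..b}" if "{a..b} \<subseteq> {0..T}" for a b
    using bounded_measurable_integrable[OF borel_measurable_lebesgue_on_subinterval[OF dm that],
        of "2*F"] db that by auto
  have gcell: "integral {real k * h..t} g = integral {real k * h..t} g0 - A k * (t - real k * h)"
    if "k < N" "real k * h \<le> t" "t \<le> real (Suc k) * h" for k t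
  proof -
    have sub: "{real k * h..t} \<subseteq> {0..T}" using cell[OF that(1)] that by auto
    have "integral {real k * h..t} g = integral {real k * h..t} (\<lambda>s. g0 s - A k)"
      by (rule integral_spike[of "{t}"]) (use that in \<open>auto simp: g_def Pcell\<close>)
    also have "\<dots> = integral {real k * h..t} g0 - integral {real k * h..t} (\<lambda>s. A k)"
      by (rule integral_diff) (use g0i[OF sub] in auto)
    finally show ?thesis using that by simp
  qed
  have grid: "integral {0..real k * h} g = 0" if "k \<le> N" for k
    using that
  proof (induction k)
    case (Suc k)
    then have k: "k < N" by simp
    have "integral {0..real k * h} g + integral {real k * h..real (Suc k) * h} g
          = integral {0..real (Suc k) * h} g"
      using cell[OF k] h0 by (intro Henstock_Kurzweil_Integration.integral_combine gi) auto
    moreover have "integral {real k * h..real (Suc k) * h} g = 0"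
      using k h0 by (subst gcell) (auto simp: A_def field_simps)
    ultimately show ?case using Suc by simp
  qed simp
  have prim: "\<bar>integral {0..t} g\<bar> \<le> 2 * h" if t: "t \<in> {0..T}" for t
  proof -
    define k where "k = nat \<lfloor>t / h\<rfloor>"
    have th: "0 \<le> t / h" using t h0 by simp
    then have k1: "real k \<le> t / h" "t / h < real k + 1" unfolding k_def by linarith+
    then have kt: "real k * h \<le> t" "t < real (Suc k) * h" using h0 by (auto simp: field_simps)
    have "real k * h \<le> real N * h" using kt t Nh by auto
    then have kN: "k \<le> N" using h0 by simp
    show ?thesis
    proof (cases "k = N")
      case True
      then have "t = real N * h" using kt t Nh by auto
      then show ?thesis using grid[of N] h0 by simp
    next
      case False
      then have k: "k < N" using kN by simp
      have "integral {0..real k * h} g + integral {real k * h..t} g = integral {0..t} g"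
        using kt t h0 by (intro Henstock_Kurzweil_Integration.integral_combine gi) auto
      then have eq: "integral {0..t} g = integral {real k * h..t} g0 - A k * (t - real k * h)"
        using grid[OF kN] gcell[OF k] kt by simp
      have 1: "t - real k * h \<le> h" using kt by (simp add: algebra_simps)
      have 2: "\<bar>integral {real k * h..t} g0\<bar> \<le> h"
        using g0int[of "real k * h" t] kt t 1 h0 by auto
      have "\<bar>A k * (t - real k * h)\<bar> \<le> 1 * h"
        unfolding abs_mult using Ab[of k] 1 kt by (intro mult_mono) auto
      then show ?thesis unfolding eq using 2 by linarith
    qed
  qed
  have zero: "integral {0..T} g = 0" using grid[of N] Nh by simp
  have b1: "integral {0..T} (\<lambda>t. f1 t * g t) \<le> 2 * h * V"
    by (rule TV_dual_bound[OF T f1 F1 V1 gm gb zero prim])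
  have mg: "(\<lambda>t. - g t) \<in> borel_measurable (lebesgue_on {0..T})"
    using gm by (rule borel_measurable_uminus)
  have b2: "integral {0..T} (\<lambda>t. f2 t * - g t) \<le> 2 * h * V"
    by (rule TV_dual_bound[OF T f2 F2 V2 mg, where K=2])
       (use gb zero prim in simp_all)
  have fg: "(\<lambda>t. f t * g' t) integrable_on {0..T}"
    if "f \<in> borel_measurable (lebesgue_on {0..T})" "\<And>t. t \<in> {0..T} \<Longrightarrow> \<bar>f t\<bar> \<le> F"
      "g' \<in> borel_measurable (lebesgue_on {0..T})" "\<And>t. \<bar>g' t\<bar> \<le> 2" for f g'
  proof (rule bounded_measurable_integrable[where K="F * 2"])
    show "(\<lambda>t. f t * g' t) \<in> borel_measurable (lebesgue_on {0..T})"
      by (intro borel_measurable_times that)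
    fix t assume t: "t \<in> {0..T}"
    then show "norm (f t * g' t) \<le> F * 2"
      unfolding real_norm_def abs_mult
      using that(2)[OF t] that(4)[of t] by (intro mult_mono) auto
  qed
  have step: "\<bar>integral {0..real k * h} (\<lambda>t. d t * P t)\<bar> \<le> real k * (2 * E)" if "k \<le> N" for k
    using that
  proof (induction k)
    case (Suc k)
    then have k: "k < N" by simp
    have s1: "{0..real (Suc k) * h} \<subseteq> {0..T}" using cell[OF k] h0 by auto
    have c: "integral {0..real k * h} (\<lambda>t. d t * P t)
             + integral {real k * h..real (Suc k) * h} (\<lambda>t. d t * P t)
          = integral {0..real (Suc k) * h} (\<lambda>t. d t * P t)"
      using s1 h0 by (intro Henstock_Kurzweil_Integration.integral_combine dPi) auto
    have c': "integral {0..real k * h} d + integral {real k * h..real (Suc k) * h} d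
          = integral {0..real (Suc k) * h} d"
      using s1 h0 by (intro Henstock_Kurzweil_Integration.integral_combine di) auto
    have "integral {real k * h..real (Suc k) * h} (\<lambda>t. d t * P t)
        = integral {real k * h..real (Suc k) * h} (\<lambda>t. d t * A k)"
      by (rule integral_spike[of "{real (Suc k) * h}"]) (auto simp: Pcell)
    also have "\<dots> = integral {real k * h..real (Suc k) * h} d * A k" by simp
    finally have eq: "integral {real k * h..real (Suc k) * h} (\<lambda>t. d t * P t)
        = (integral {0..real (Suc k) * h} d - integral {0..real k * h} d) * A k"
      using c' by simp
    have "real k * h \<le> real (Suc k) * h" using h0 by simp
    then have "real k * h \<in> {0..T}" "real (Suc k) * h \<in> {0..T}"
      using cell[OF k] by (simp_all add: subset_iff)
    then have "\<bar>integral {0..real (Suc k) * h} d - integral {0..real k * h} d\<bar> \<le> 2 * E"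
      using E[of "real k * h"] E[of "real (Suc k) * h"] unfolding d_def by linarith
    then have "\<bar>(integral {0..real (Suc k) * h} d - integral {0..real k * h} d) * A k\<bar> \<le> (2 * E) * 1"
      unfolding abs_mult using Ab[of k] by (intro mult_mono) auto
    then have "\<bar>integral {0..real (Suc k) * h} (\<lambda>t. d t * P t)\<bar> \<le> real k * (2 * E) + 2 * E"
      using Suc.IH k unfolding c[symmetric] eq by linarith
    then show ?case by (simp add: algebra_simps)
  qed simp
  have "integral {0..T} (\<lambda>t. \<bar>d t\<bar>)
      = integral {0..T} (\<lambda>t. (f1 t * g t + f2 t * - g t) + d t * P t)"
    by (rule integral_cong) (auto simp: g_def g0_def d_def abs_sgn algebra_simps)
  also have "\<dots> = integral {0..T} (\<lambda>t. f1 t * g t) + integral {0..T} (\<lambda>t. f2 t * - g t)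
      + integral {0..T} (\<lambda>t. d t * P t)"
  proof -
    have 1: "(\<lambda>t. f1 t * g t) integrable_on {0..T}" using gb by (intro fg f1 F1 gm)
    have 2: "(\<lambda>t. f2 t * - g t) integrable_on {0..T}" using gb by (intro fg f2 F2 mg) auto
    have 3: "(\<lambda>t. d t * P t) integrable_on {0..T}" by (intro dPi) auto
    show ?thesis using integral_add[OF integrable_add[OF 1 2] 3] integral_add[OF 1 2] by simp
  qed
  also have "\<dots> \<le> 2 * h * V + 2 * h * V + N * (2 * E)"
  proof -
    have "integral {0..T} (\<lambda>t. d t * P t) \<le> N * (2 * E)" using step[of N] unfolding Nh by simp
    with b1 b2 show ?thesis by linarith
  qed
  also have "\<dots> = 4 * T / real N * V + 2 * real N * E" by (simp add: h_def)
  finally show ?thesis by (simp add: d_def)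
qed

text \<open>
  Compactness: controls of uniformly bounded total variation have an almost everywhere convergent
  subsequence. The primitives are equi-Lipschitz, so a subsequence of them converges uniformly;
  the interpolation inequality turns this into the Cauchy property in \<open>L\<^sup>1\<close>.
\<close>

lemma TV_bounded_compact:
  fixes f :: "nat \<Rightarrow> real \<Rightarrow> real ^ 'r::finite"
  assumes T: "0 < T"
    and fm: "\<And>n. f n \<in> borel_measurable (lebesgue_on {0..T})"
    and box: "\<And>n t. f n t \<in> control_box"
    and V: "\<And>n i. TV T (\<lambda>t. f n t $ i) \<le> ereal V"
  obtains r u where "strict_mono (r :: nat \<Rightarrow> nat)"
    "u \<in> borel_measurable (lebesgue_on {0..T})" "\<And>t. u t \<in> control_box"
    "AE t in lebesgue_on {0..T}. (\<lambda>n. f (r n) t) \<longlonglongrightarrow> u t"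
proof -
  define B where "B = real CARD('r)"
  have nb: "norm (f n t) \<le> B" for n t
  proof -
    have "norm (f n t) \<le> (\<Sum>i\<in>UNIV. \<bar>f n t $ i\<bar>)" by (rule norm_le_l1_cart)
    also have "\<dots> \<le> (\<Sum>i\<in>(UNIV::'r set). 1)"
      using box[of n t] by (intro sum_mono) (auto simp: control_box_def)
    finally show ?thesis by (simp add: B_def)
  qed
  have B0: "0 < B" by (simp add: B_def)
  have fi: "f n integrable_on {a..b}" if "{a..b} \<subseteq> {0..T}" for n a b
    using bounded_measurable_integrable[OF borel_measurable_lebesgue_on_subinterval[OF fm that]] nb
    by blast
  define F where "F n t = integral {0..t} (f n)" for n t
  have Fb: "norm (integral {a..b} (f n)) \<le> B * (b - a)" if "{a..b} \<subseteq> {0..T}" "a \<le> b" for n a b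
    using integral_norm_bound_integral[OF fi[OF that(1)], of "\<lambda>_. B"] nb that by (auto simp: mult.commute)
  have Flip: "norm (F n s - F n t) \<le> B * \<bar>s - t\<bar>" if "s \<in> {0..T}" "t \<in> {0..T}" for n s t
  proof -
    have *: "norm (F n t - F n s) \<le> B * (t - s)" if "s \<in> {0..T}" "t \<in> {0..T}" "s \<le> t" for s t
    proof -
      have "F n s + integral {s..t} (f n) = F n t"
        unfolding F_def using that
        by (intro Henstock_Kurzweil_Integration.integral_combine fi) auto
      then have "F n t - F n s = integral {s..t} (f n)" by (simp add: algebra_simps)
      then show ?thesis using Fb[of s t n] that by simp
    qed
    show ?thesis
    proof (cases "s \<le> t")
      case True then show ?thesis using *[OF that] by (simp add: norm_minus_commute)
    next
      case False then show ?thesis using *[OF that(2,1)] by simp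
    qed
  qed
  have Fbd: "norm (F n t) \<le> B * T" if "t \<in> {0..T}" for n t
  proof -
    have "norm (F n t - F n 0) \<le> B * t" using Flip[of t 0 n] that T by simp
    also have "\<dots> \<le> B * T" using that B0 by simp
    finally show ?thesis by (simp add: F_def)
  qed
  have equi: "\<exists>d>0. \<forall>n y. y \<in> {0..T} \<and> norm (s - y) < d \<longrightarrow> norm (F n s - F n y) < e"
    if "s \<in> {0..T}" "0 < e" for s e
  proof (intro exI[of _ "e / B"] conjI allI impI)
    fix n y assume y: "y \<in> {0..T} \<and> norm (s - y) < e / B"
    then have "B * \<bar>s - y\<bar> < e" using B0 by (simp add: field_simps)
    then show "norm (F n s - F n y) < e" using Flip[OF that(1), of y n] y by linarith
  qed (use that B0 in simp)
  obtain G k where k: "strict_mono (k::nat \<Rightarrow> nat)"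
    and conv: "\<And>e. 0 < e \<Longrightarrow> \<exists>N. \<forall>n x. n \<ge> N \<and> x \<in> {0..T} \<longrightarrow> norm (F (k n) x - G x) < e"
    using Arzela_Ascoli[of "{0..T}" F "B * T", OF compact_Icc Fbd equi] by metis
  have comp: "\<exists>M. \<forall>m\<ge>M. \<forall>n\<ge>M. integral {0..T} (\<lambda>t. \<bar>f (k m) t $ i - f (k n) t $ i\<bar>) < e"
    if e: "0 < e" for e i
  proof -
    \<comment> \<open>First \<open>N\<close> is chosen to make the variation term smaller than \<open>e / 2\<close>, and then \<open>\<delta>\<close> to make the
       other one equal to \<open>e / 2\<close>.\<close>
    obtain N0 where N0: "8 * T * \<bar>V\<bar> / e < real N0" using reals_Archimedean2 by blast
    define N where "N = Suc N0"
    have NN: "0 < N" "8 * T * \<bar>V\<bar> / e < real N" using N0 by (auto simp: N_def)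
    define \<delta> where "\<delta> = e / (8 * real N)"
    have \<delta>: "\<delta> > 0" using e NN by (simp add: \<delta>_def)
    obtain M where M: "\<And>n x. n \<ge> M \<Longrightarrow> x \<in> {0..T} \<Longrightarrow> norm (F (k n) x - G x) < \<delta>"
      using conv[OF \<delta>] by blast
    show ?thesis
    proof (intro exI[of _ M] allI impI)
      fix m n assume mn: "m \<ge> M" "n \<ge> M"
      have "integral {0..T} (\<lambda>t. \<bar>f (k m) t $ i - f (k n) t $ i\<bar>) \<le> 4 * T / real N * V + 2 * real N * (2 * \<delta>)"
      proof (rule L1_interpolation[OF T NN(1), where F=B])
        show "(\<lambda>t. f (k m) t $ i) \<in> borel_measurable (lebesgue_on {0..T})"
          "(\<lambda>t. f (k n) t $ i) \<in> borel_measurable (lebesgue_on {0..T})"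
          by (rule borel_measurable_vec_nth[OF fm])+
        show "\<bar>f (k m) t $ i\<bar> \<le> B" "\<bar>f (k n) t $ i\<bar> \<le> B" for t
          by (rule order_trans[OF component_le_norm_cart nb])+
        fix t assume t: "t \<in> {0..T}"
        have sub: "{0..t} \<subseteq> {0..T}" using t by auto
        have "integral {0..t} (\<lambda>s. f (k m) s $ i - f (k n) s $ i)
            = integral {0..t} (\<lambda>s. (f (k m) s - f (k n) s) $ i)" by simp
        also have "\<dots> = integral {0..t} (\<lambda>s. f (k m) s - f (k n) s) $ i"
          using integral_linear[OF integrable_diff[OF fi[OF sub] fi[OF sub]] bounded_linear_vec_nth]
          by (simp add: o_def)
        also have "integral {0..t} (\<lambda>s. f (k m) s - f (k n) s) = F (k m) t - F (k n) t"
          unfolding F_def by (rule integral_diff[OF fi[OF sub] fi[OF sub]])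
        finally have "\<bar>integral {0..t} (\<lambda>s. f (k m) s $ i - f (k n) s $ i)\<bar> \<le> norm (F (k m) t - F (k n) t)"
          using component_le_norm_cart by metis
        also have "\<dots> \<le> norm (F (k m) t - G t) + norm (F (k n) t - G t)"
          using norm_triangle_ineq4[of "F (k m) t - G t" "F (k n) t - G t"] by simp
        also have "\<dots> \<le> 2 * \<delta>" using M[OF mn(1) t] M[OF mn(2) t] by simp
        finally show "\<bar>integral {0..t} (\<lambda>s. f (k m) s $ i - f (k n) s $ i)\<bar> \<le> 2 * \<delta>" .
      qed (use V in auto)
      also have "2 * real N * (2 * \<delta>) = e / 2" using NN by (simp add: \<delta>_def)
      also have "4 * T / real N * V + e / 2 < e"
      proof -
        have "4 * T / real N * V \<le> 4 * T / real N * \<bar>V\<bar>" using T by (intro mult_left_mono) auto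
        also have "\<dots> < e / 2" using NN e by (simp add: field_simps)
        finally show ?thesis by simp
      qed
      finally show "integral {0..T} (\<lambda>t. \<bar>f (k m) t $ i - f (k n) t $ i\<bar>) < e" .
    qed
  qed
  have int: "integrable (lebesgue_on {0..T}) (f n)" for n
    using bounded_measurable_absolutely_integrable[OF fm nb]
    by (simp add: set_integrable_def integrable_restrict_space)
  have cauchy: "\<exists>M. \<forall>m\<ge>M. \<forall>n\<ge>M. (LINT t|lebesgue_on {0..T}. norm (f (k m) t - f (k n) t)) < e"
    if e: "0 < e" for e
  proof -
    have "\<forall>i. \<exists>M. \<forall>m\<ge>M. \<forall>n\<ge>M. integral {0..T} (\<lambda>t. \<bar>f (k m) t $ i - f (k n) t $ i\<bar>) < e / B"
      using comp e B0 by simp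
    from choice[OF this] obtain M where M: "\<And>i m n. m \<ge> M i \<Longrightarrow> n \<ge> M i \<Longrightarrow>
        integral {0..T} (\<lambda>t. \<bar>f (k m) t $ i - f (k n) t $ i\<bar>) < e / B" by blast
    show ?thesis
    proof (intro exI[of _ "Max (range M)"] allI impI)
      fix m n assume "m \<ge> Max (range M)" "n \<ge> Max (range M)"
      then have mn: "m \<ge> M i" "n \<ge> M i" for i
        using Max_ge[of "range M" "M i"] by (auto intro: order_trans)
      have i1: "integrable (lebesgue_on {0..T}) (\<lambda>t. norm (f (k m) t - f (k n) t))"
        by (intro integrable_norm Bochner_Integration.integrable_diff int)
      have i2: "(\<lambda>t. \<bar>f (k m) t $ i - f (k n) t $ i\<bar>) integrable_on {0..T}" for i
      proof (rule bounded_measurable_integrable[where K="B+B"])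
        show "(\<lambda>t. \<bar>f (k m) t $ i - f (k n) t $ i\<bar>) \<in> borel_measurable (lebesgue_on {0..T})"
          by (intro borel_measurable_abs borel_measurable_diff borel_measurable_vec_nth fm)
        fix t
        have "\<bar>f (k m) t $ i\<bar> \<le> B" "\<bar>f (k n) t $ i\<bar> \<le> B"
          by (rule order_trans[OF component_le_norm_cart nb])+
        then show "norm \<bar>f (k m) t $ i - f (k n) t $ i\<bar> \<le> B + B" by simp
      qed
      have "(LINT t|lebesgue_on {0..T}. norm (f (k m) t - f (k n) t))
          = integral {0..T} (\<lambda>t. norm (f (k m) t - f (k n) t))"
        using i1 by (rule lebesgue_integral_eq_integral) auto
      also have "\<dots> \<le> integral {0..T} (\<lambda>t. \<Sum>i\<in>UNIV. \<bar>f (k m) t $ i - f (k n) t $ i\<bar>)"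
      proof (rule integral_le)
        show "(\<lambda>t. norm (f (k m) t - f (k n) t)) integrable_on {0..T}"
          using i1 by (rule integrable_on_lebesgue_on) auto
        show "norm (f (k m) t - f (k n) t) \<le> (\<Sum>i\<in>UNIV. \<bar>f (k m) t $ i - f (k n) t $ i\<bar>)" for t
          using norm_le_l1_cart[of "f (k m) t - f (k n) t"] by simp
      qed (intro integrable_sum i2, simp)
      also have "\<dots> = (\<Sum>i\<in>UNIV. integral {0..T} (\<lambda>t. \<bar>f (k m) t $ i - f (k n) t $ i\<bar>))"
        by (intro integral_sum i2) simp
      also have "\<dots> < (\<Sum>i\<in>(UNIV::'r set). e / B)"
        by (intro sum_strict_mono M mn) auto
      also have "\<dots> = e" using B0 by (simp add: B_def)
      finally show "(LINT t|lebesgue_on {0..T}. norm (f (k m) t - f (k n) t)) < e" .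
    qed
  qed
  obtain s where s: "strict_mono s" and ae: "AE t in lebesgue_on {0..T}. Cauchy (\<lambda>n. f (k (s n)) t)"
    using cauchy_L1_AE_cauchy_subseq[of "lebesgue_on {0..T}" "\<lambda>n. f (k n)", OF int cauchy]
    by metis
  define u where "u t = (if Cauchy (\<lambda>n. f (k (s n)) t) then lim (\<lambda>n. f (k (s n)) t) else 0)" for t
  have lim: "(\<lambda>n. f (k (s n)) t) \<longlonglongrightarrow> u t" if "Cauchy (\<lambda>n. f (k (s n)) t)" for t
    using that by (simp add: u_def Cauchy_convergent_iff convergent_LIMSEQ_iff)
  have cl: "closed (control_box :: 'r controls set)"
  proof -
    have "control_box = (cbox 0 (\<chi> i. 1) :: 'r controls set)"
      by (auto simp: control_box_def mem_box_cart)
    then show ?thesis by (metis closed_cbox)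
  qed
  have um: "u \<in> borel_measurable (lebesgue_on {0..T})"
    unfolding u_def
  proof (rule measurable_If)
    show "{t \<in> space (lebesgue_on {0..T}). Cauchy (\<lambda>n. f (k (s n)) t)} \<in> sets (lebesgue_on {0..T})"
      using fm by (rule sets_Collect_Cauchy)
    show "(\<lambda>t. lim (\<lambda>n. f (k (s n)) t)) \<in> borel_measurable (lebesgue_on {0..T})"
      using fm by (rule borel_measurable_lim_metric)
  qed simp
  have ubox: "u t \<in> control_box" for t
  proof (cases "Cauchy (\<lambda>n. f (k (s n)) t)")
    case True
    show ?thesis by (rule closed_sequentially[OF cl _ lim[OF True]]) (rule box)
  qed (simp add: u_def control_box_def)
  have uae: "AE t in lebesgue_on {0..T}. (\<lambda>n. f (k (s n)) t) \<longlonglongrightarrow> u t"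
    using ae by eventually_elim (rule lim)
  have ks: "strict_mono (\<lambda>n. k (s n))" using k s by (simp add: strict_mono_def)
  show thesis by (rule that[OF ks um ubox uae])
qed

section \<open>Global existence for Lipschitz equations with measurable time dependence\<close>

text \<open>
  Picard iteration. The weight \<open>exp (2 * L * t)\<close> makes the integral operator a contraction with factor
  \<open>1/2\<close>, so that no restriction on \<open>T\<close> is needed.
\<close>

lemma caratheodory_existence:
  fixes G :: "real \<Rightarrow> 'a::euclidean_space \<Rightarrow> 'a"
  assumes T: "0 \<le> T"
    and m: "\<And>x. continuous_on {0..T} x \<Longrightarrow> (\<lambda>s. G s (x s)) \<in> borel_measurable (lebesgue_on {0..T})"
    and K: "\<And>s x. s \<in> {0..T} \<Longrightarrow> norm (G s x) \<le> K"
    and L: "\<And>s x y. s \<in> {0..T} \<Longrightarrow> norm (G s x - G s y) \<le> L * norm (x - y)" and L0: "0 < L"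
  obtains x where "continuous_on {0..T} x"
    "\<And>t. t \<in> {0..T} \<Longrightarrow> x t = x0 + integral {0..t} (\<lambda>s. G s (x s))"
proof -
  have K0: "0 \<le> K" using K[of 0] T norm_ge_zero order_trans by (metis atLeastAtMost_iff order_refl)
  define X where "X n = ((\<lambda>x t. x0 + integral {0..t} (\<lambda>s. G s (x s))) ^^ n) (\<lambda>_. x0)" for n
  have X0: "X 0 = (\<lambda>_. x0)" by (simp add: X_def)
  have XS: "X (Suc n) = (\<lambda>t. x0 + integral {0..t} (\<lambda>s. G s (X n s)))" for n
    by (simp add: X_def)
  have Gi: "(\<lambda>s. G s (x s)) integrable_on {0..t}" if "continuous_on {0..T} x" "t \<in> {0..T}" for x t
    by (rule bounded_measurable_integrable[where K=K,
          OF borel_measurable_lebesgue_on_subinterval[OF m[OF that(1)]]])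
       (use that K in auto)
  have Xc: "continuous_on {0..T} (X n)" for n
  proof (induction n)
    case (Suc n)
    then show ?case unfolding XS
      using T by (intro continuous_intros indefinite_integral_continuous_1 Gi) auto
  qed (simp add: X0)
  define M where "M = K * T"
  have M0: "0 \<le> M" using K0 T by (simp add: M_def)
  have step: "norm (X (Suc n) t - X n t) \<le> M * (1/2)^n * exp (2 * L * t)" if "t \<in> {0..T}" for n t
    using that
  proof (induction n arbitrary: t)
    case 0
    have "norm (integral {0..t} (\<lambda>s. G s (X 0 s))) \<le> integral {0..t} (\<lambda>_. K)"
      using 0 K by (intro integral_norm_bound_integral Gi Xc) auto
    also have "\<dots> = K * t" using 0 by simp
    also have "\<dots> \<le> M" using 0 K0 by (simp add: M_def mult_left_mono)
    also have "\<dots> \<le> M * exp (2 * L * t)"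
      using M0 L0 0 by (simp add: mult_le_cancel_left1)
    finally show ?case by (simp add: XS X0)
  next
    case (Suc n)
    have ex: "((\<lambda>s. L * (M * (1/2)^n * exp (2 * L * s))) has_integral
          (M * (1/2)^n * exp (2 * L * t) / 2 - M * (1/2)^n * exp (2 * L * 0) / 2)) {0..t}"
      by (rule fundamental_theorem_of_calculus)
         (use Suc.prems L0 in \<open>auto intro!: derivative_eq_intros
            simp: has_real_derivative_iff_has_vector_derivative[symmetric]\<close>)
    have "norm (X (Suc (Suc n)) t - X (Suc n) t)
        = norm (integral {0..t} (\<lambda>s. G s (X (Suc n) s) - G s (X n s)))"
      using integral_diff[OF Gi[OF Xc Suc.prems] Gi[OF Xc Suc.prems], of "Suc n" n]
      by (simp add: XS[of "Suc n"] XS[of n])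
    also have "\<dots> \<le> integral {0..t} (\<lambda>s. L * (M * (1/2)^n * exp (2 * L * s)))"
    proof (rule integral_norm_bound_integral)
      show "(\<lambda>s. G s (X (Suc n) s) - G s (X n s)) integrable_on {0..t}"
        using Suc.prems by (intro integrable_diff Gi Xc)
      show "(\<lambda>s. L * (M * (1/2)^n * exp (2 * L * s))) integrable_on {0..t}"
        using ex by (rule has_integral_integrable)
      fix s assume "s \<in> {0..t}"
      then have s: "s \<in> {0..T}" using Suc.prems by auto
      have "norm (G s (X (Suc n) s) - G s (X n s)) \<le> L * norm (X (Suc n) s - X n s)" by (rule L[OF s])
      also have "\<dots> \<le> L * (M * (1/2)^n * exp (2 * L * s))"
        using Suc.IH[OF s] L0 by (intro mult_left_mono) auto
      finally show "norm (G s (X (Suc n) s) - G s (X n s)) \<le> L * (M * (1/2)^n * exp (2 * L * s))" .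
    qed
    also have "\<dots> = M * (1/2)^n * exp (2 * L * t) / 2 - M * (1/2)^n / 2"
      using integral_unique[OF ex] by simp
    also have "\<dots> \<le> M * (1/2)^Suc n * exp (2 * L * t)" using M0 by simp
    finally show ?case .
  qed
  have step': "norm (X (Suc n) t - X n t) \<le> M * exp (2 * L * T) * (1/2)^n" if t: "t \<in> {0..T}" for n t
  proof -
    have "M * (1/2)^n * exp (2 * L * t) \<le> M * (1/2)^n * exp (2 * L * T)"
      using t M0 L0 by (intro mult_left_mono) auto
    with step[OF t, of n] show ?thesis by (simp add: mult_ac)
  qed
  have tele: "X n t = x0 + (\<Sum>i<n. X (Suc i) t - X i t)" for n t
    by (induction n) (auto simp: X0)
  define x where "x t = x0 + (\<Sum>i. X (Suc i) t - X i t)" for t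
  have ul: "uniform_limit {0..T} (\<lambda>n t. \<Sum>i<n. X (Suc i) t - X i t) (\<lambda>t. \<Sum>i. X (Suc i) t - X i t) sequentially"
    by (rule Weierstrass_m_test[where M="\<lambda>n. M * exp (2 * L * T) * (1/2)^n"])
       (use step' in \<open>auto intro!: summable_mult summable_geometric\<close>)
  have "uniform_limit {0..T} (\<lambda>n t. x0 + (\<Sum>i<n. X (Suc i) t - X i t)) x sequentially"
    unfolding x_def by (intro uniform_limit_add uniform_limit_const ul)
  then have ulX: "uniform_limit {0..T} X x sequentially"
    by (simp flip: tele)
  have xc: "continuous_on {0..T} x"
    by (rule uniform_limit_theorem[OF _ ulX]) (auto simp: Xc)
  have lim: "(\<lambda>n. X n t) \<longlonglongrightarrow> x t" if "t \<in> {0..T}" for t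
    by (rule tendsto_uniform_limitI[OF ulX that])
  show thesis
  proof (rule that[OF xc])
    fix t assume t: "t \<in> {0..T}"
    have "(\<lambda>n. integral {0..t} (\<lambda>s. G s (X n s))) \<longlonglongrightarrow> integral {0..t} (\<lambda>s. G s (x s))"
    proof (rule bounded_convergence_ae[where K=K and N="{}"])
      fix n show "(\<lambda>s. G s (X n s)) \<in> borel_measurable (lebesgue_on {0..t})"
        by (rule borel_measurable_lebesgue_on_subinterval[OF m[OF Xc]]) (use t in auto)
    next
      fix n s assume "s \<in> {0..t}"
      then show "norm (G s (X n s)) \<le> K" using t by (intro K) auto
    next
      fix s assume "s \<in> {0..t} - {}"
      then have s: "s \<in> {0..T}" using t by auto
      have "(\<lambda>n. L * norm (X n s - x s)) \<longlonglongrightarrow> L * norm (x s - x s)"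
        by (intro tendsto_intros lim s)
      then have l0: "(\<lambda>n. L * norm (X n s - x s)) \<longlonglongrightarrow> 0" by simp
      have "(\<lambda>n. G s (X n s) - G s (x s)) \<longlonglongrightarrow> 0"
        by (rule Lim_null_comparison[OF _ l0]) (auto intro!: always_eventually L[OF s])
      then show "(\<lambda>n. G s (X n s)) \<longlonglongrightarrow> G s (x s)" by (simp add: LIM_zero_iff)
    qed simp
    then have "(\<lambda>n. X (Suc n) t) \<longlonglongrightarrow> x0 + integral {0..t} (\<lambda>s. G s (x s))"
      unfolding XS by (intro tendsto_add tendsto_const)
    moreover have "(\<lambda>n. X (Suc n) t) \<longlonglongrightarrow> x t"
      using lim[OF t] by (rule LIMSEQ_Suc)
    ultimately show "x t = x0 + integral {0..t} (\<lambda>s. G s (x s))" using LIMSEQ_unique by blast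
  qed
qed

section \<open>The numerical flux\<close>

lemma deriv_road_flux: "deriv road_flux r = 1 - 2 * r"
  by (rule DERIV_imp_deriv) (auto simp: road_flux_def[abs_def] intro!: derivative_eq_intros)

lemma num_flux_eq:
  "num_flux u v = (u * (1 - u) + v * (1 - v)) / 2 - max (abs (1 - 2 * u)) (abs (1 - 2 * v)) * ((v - u) / 2)"
  by (simp add: num_flux_def deriv_road_flux road_flux_def)

text \<open>
  In the mass balance, only the sign of the flux between densities of opposite signs matters. The
  viscosity coefficient \<open>max \<bar>1 - 2 * u\<bar> \<bar>1 - 2 * v\<bar>\<close> dominates the quadratic terms of the centred flux.
\<close>

lemma num_flux_nonneg:
  assumes "0 \<le> u" "v \<le> 0"
  shows "0 \<le> num_flux u v"
proof -
  define a where "a = max (abs (1 - 2 * u)) (abs (1 - 2 * v))"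
  have "1 - 2 * v \<le> a" "2 * u - 1 \<le> a" by (auto simp: a_def)
  then have "(1 - 2 * v) * (-v) \<le> a * (-v)" "(2 * u - 1) * u \<le> a * u"
    using assms by (intro mult_right_mono; simp)+
  moreover have "2 * num_flux u v = u * (1 - u) + v * (1 - v) + a * (-v) + a * u"
    unfolding num_flux_eq a_def[symmetric] by (simp add: field_simps)
  ultimately have "2 * num_flux u v \<ge> u * (1 - u) + v * (1 - v) + (1 - 2 * v) * (-v) + (2 * u - 1) * u"
    by linarith
  also have "u * (1 - u) + v * (1 - v) + (1 - 2 * v) * (-v) + (2 * u - 1) * u = u\<^sup>2 + v\<^sup>2"
    by (simp add: power2_eq_square algebra_simps)
  finally show ?thesis using sum_power2_ge_zero[of u v] by linarith
qed

lemma num_flux_nonpos: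
  assumes "u \<le> 0" "0 \<le> v"
  shows "num_flux u v \<le> 0"
proof -
  define a where "a = max (abs (1 - 2 * u)) (abs (1 - 2 * v))"
  have "1 \<le> a" using assms by (auto simp: a_def)
  then have "v - u \<le> a * (v - u)"
    using mult_right_mono[of 1 a "v - u"] assms by simp
  moreover have "2 * num_flux u v = u * (1 - u) + v * (1 - v) - a * (v - u)"
    unfolding num_flux_eq a_def[symmetric] by (simp add: field_simps)
  ultimately have "2 * num_flux u v \<le> u * (1 - u) + v * (1 - v) - (v - u)" by simp
  also have "\<dots> = 2 * u - (u\<^sup>2 + v\<^sup>2)"
    by (simp add: power2_eq_square algebra_simps)
  finally show ?thesis using sum_power2_ge_zero[of u v] assms by linarith
qed

text \<open>
  The exchange of mass across the interface between two cells never increases the sum of the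
  absolute values of their masses.
\<close>

lemma num_flux_dissipative: "(sgn v - sgn u) * num_flux u v \<le> 0"
  using num_flux_nonneg[of u v] num_flux_nonpos[of u v]
  by (auto simp: sgn_real_def mult_le_0_iff)

lemma num_flux_lipschitz:
  assumes "\<bar>u\<bar> \<le> R" "\<bar>v\<bar> \<le> R" "\<bar>u'\<bar> \<le> R" "\<bar>v'\<bar> \<le> R"
  shows "\<bar>num_flux u v - num_flux u' v'\<bar> \<le> (1 + 4 * R) * (\<bar>u - u'\<bar> + \<bar>v - v'\<bar>)"
proof -
  define a where "a = max (abs (1 - 2 * u)) (abs (1 - 2 * v))"
  define a' where "a' = max (abs (1 - 2 * u')) (abs (1 - 2 * v'))"
  have q: "\<bar>x * (1 - x) - y * (1 - y)\<bar> \<le> (1 + 2 * R) * \<bar>x - y\<bar>" if "\<bar>x\<bar> \<le> R" "\<bar>y\<bar> \<le> R" for x y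
  proof -
    have "x * (1 - x) - y * (1 - y) = (1 - x - y) * (x - y)" by (simp add: algebra_simps)
    then show ?thesis using that by (simp add: abs_mult mult_right_mono)
  qed
  have 1: "\<bar>a\<bar> \<le> 1 + 2 * R" using assms by (auto simp: a_def)
  have 2: "\<bar>(v - u) / 2 - (v' - u') / 2\<bar> \<le> (\<bar>u - u'\<bar> + \<bar>v - v'\<bar>) / 2"
  proof -
    have "(v - u) / 2 - (v' - u') / 2 = ((v - v') - (u - u')) / 2" by (simp add: field_simps)
    then have "\<bar>(v - u) / 2 - (v' - u') / 2\<bar> = \<bar>(v - v') - (u - u')\<bar> / 2" by (simp only: abs_divide abs_numeral)
    also have "\<dots> \<le> (\<bar>v - v'\<bar> + \<bar>u - u'\<bar>) / 2"
      by (intro divide_right_mono abs_triangle_ineq4) simp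
    finally show ?thesis by (simp only: add.commute)
  qed
  have 3: "\<bar>a - a'\<bar> \<le> 2 * (\<bar>u - u'\<bar> + \<bar>v - v'\<bar>)"
  proof -
    have "\<bar>max p q - max p' q'\<bar> \<le> \<bar>p - p'\<bar> + \<bar>q - q'\<bar>" for p q p' q' :: real by linarith
    then have "\<bar>a - a'\<bar> \<le> \<bar>\<bar>1 - 2 * u\<bar> - \<bar>1 - 2 * u'\<bar>\<bar> + \<bar>\<bar>1 - 2 * v\<bar> - \<bar>1 - 2 * v'\<bar>\<bar>"
      unfolding a_def a'_def .
    moreover have "\<bar>\<bar>1 - 2 * r\<bar> - \<bar>1 - 2 * r'\<bar>\<bar> \<le> 2 * \<bar>r - r'\<bar>" for r r' :: real
      using abs_triangle_ineq3[of "1 - 2 * r" "1 - 2 * r'"] abs_mult[of 2 "r - r'"]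
      by (simp add: abs_minus_commute algebra_simps)
    ultimately show ?thesis by (smt (verit))
  qed
  have 4: "\<bar>(v' - u') / 2\<bar> \<le> R" using assms by (simp add: abs_le_iff)
  have "num_flux u v - num_flux u' v'
     = ((u * (1 - u) - u' * (1 - u')) + (v * (1 - v) - v' * (1 - v'))) / 2
       - (a * ((v - u) / 2 - (v' - u') / 2) + (a - a') * ((v' - u') / 2))"
    unfolding num_flux_eq a_def[symmetric] a'_def[symmetric] by (simp add: field_simps)
  moreover have gen: "\<bar>(P + Q) / 2 - (A + B)\<bar> \<le> (p + q) / 2 + (\<alpha> + \<beta>)"
    if "\<bar>P\<bar> \<le> p" "\<bar>Q\<bar> \<le> q" "\<bar>A\<bar> \<le> \<alpha>" "\<bar>B\<bar> \<le> \<beta>" for P Q A B p q \<alpha> \<beta> :: real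
    using that unfolding abs_le_iff by (simp add: field_simps)
  moreover have "\<bar>a * ((v - u) / 2 - (v' - u') / 2)\<bar> \<le> (1 + 2 * R) * ((\<bar>u - u'\<bar> + \<bar>v - v'\<bar>) / 2)"
    unfolding abs_mult using 1 2 by (intro mult_mono) auto
  moreover have "\<bar>(a - a') * ((v' - u') / 2)\<bar> \<le> 2 * (\<bar>u - u'\<bar> + \<bar>v - v'\<bar>) * R"
    unfolding abs_mult using 3 4 by (intro mult_mono) auto
  ultimately have "\<bar>num_flux u v - num_flux u' v'\<bar> \<le>
      ((1 + 2 * R) * \<bar>u - u'\<bar> + (1 + 2 * R) * \<bar>v - v'\<bar>) / 2
      + ((1 + 2 * R) * ((\<bar>u - u'\<bar> + \<bar>v - v'\<bar>) / 2) + 2 * (\<bar>u - u'\<bar> + \<bar>v - v'\<bar>) * R)"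
    using gen[OF q[OF assms(1,3)] q[OF assms(2,4)]] by simp
  also have "\<dots> = (1 + 4 * R) * (\<bar>u - u'\<bar> + \<bar>v - v'\<bar>)" by (simp add: field_simps)
  finally show ?thesis .
qed

section \<open>The finite volume field: mass balance and Lipschitz estimate\<close>

lemma next_cell_gt:
  assumes "j \<noteq> Max UNIV"
  shows "j < next_cell j"
proof -
  have "j < Max UNIV" using assms by (simp add: order_less_le)
  then have "{k. j < k} \<noteq> {}" by blast
  then have "next_cell j \<in> {k. j < k}" unfolding next_cell_def by (intro Min_in) auto
  then show ?thesis by simp
qed

lemma prev_cell_less:
  assumes "j \<noteq> Min UNIV"
  shows "prev_cell j < j"
proof -
  have "Min UNIV < j" using assms by (metis Min_le UNIV_I finite order_less_le)
  then have "{k. k < j} \<noteq> {}" by blast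
  then have "prev_cell j \<in> {k. k < j}" unfolding prev_cell_def by (intro Max_in) auto
  then show ?thesis by simp
qed

lemma prev_next_cell:
  assumes "j \<noteq> Max UNIV"
  shows "prev_cell (next_cell j) = j"
  unfolding prev_cell_def
proof (rule Max_eqI)
  fix k assume "k \<in> {k. k < next_cell j}"
  then have "\<not> next_cell j \<le> k" by simp
  then have "k \<notin> {k. j < k}" unfolding next_cell_def by (metis Min_le finite)
  then show "k \<le> j" by simp
qed (use next_cell_gt[OF assms] in auto)

lemma next_prev_cell:
  assumes "j \<noteq> Min UNIV"
  shows "next_cell (prev_cell j) = j"
  unfolding next_cell_def
proof (rule Min_eqI)
  fix k assume "k \<in> {k. prev_cell j < k}"
  then have "\<not> k \<le> prev_cell j" by simp
  then have "k \<notin> {k. k < j}" unfolding prev_cell_def by (metis Max_ge finite)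
  then show "j \<le> k" by simp
qed (use prev_cell_less[OF assms] in auto)

lemma next_cell_neq_Min: "j \<noteq> Max UNIV \<Longrightarrow> next_cell j \<noteq> Min UNIV"
  using next_cell_gt[of j] by (metis Min_le UNIV_I finite leD)

lemma prev_cell_neq_Max: "j \<noteq> Min UNIV \<Longrightarrow> prev_cell j \<noteq> Max UNIV"
  using prev_cell_less[of j] by (metis Max_ge UNIV_I finite leD)

text \<open>
  Both sums run over the interfaces between consecutive cells, indexed on the left by
  the cell in front and on the right by the cell behind.
\<close>

lemma sum_shift_cells:
  fixes f :: "'c::{finite,linorder} \<Rightarrow> 'c \<Rightarrow> real"
  shows "(\<Sum>j\<in>UNIV - {Min UNIV}. f (prev_cell j) j) = (\<Sum>j\<in>UNIV - {Max UNIV}. f j (next_cell j))"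
  by (rule sum.reindex_bij_witness[where i=next_cell and j=prev_cell])
     (auto simp: prev_next_cell next_prev_cell next_cell_neq_Min prev_cell_neq_Max)

text \<open>
  Summation by parts on each road: with the weights \<open>sgn \<rho>\<close>, the contributions of the inner
  interfaces are nonpositive, and only the boundary fluxes remain. The bound does not involve the
  quadratic numerical flux, which excludes blow-up.
\<close>

lemma fv_field_dissipation:
  fixes \<rho> :: "('c::{finite,linorder}, 'r::finite) densities"
  assumes "\<And>i j. 0 < \<Delta>x i j"
  shows "(\<Sum>i\<in>UNIV. \<Sum>j\<in>UNIV. \<Delta>x i j * (sgn (\<rho> $ i $ j) * fv_field \<Delta>x \<rho> \<gamma> $ i $ j))
    \<le> (\<Sum>i\<in>UNIV. \<bar>fst \<gamma> $ i\<bar> + \<bar>snd \<gamma> $ i\<bar>)"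
proof (rule sum_mono)
  fix i
  define s where "s j = sgn (\<rho> $ i $ j)" for j
  define F where "F j k = num_flux (\<rho> $ i $ j) (\<rho> $ i $ k)" for j k
  define L where "L = fst \<gamma> $ i"
  define R where "R = snd \<gamma> $ i"
  have eq: "\<Delta>x i j * (sgn (\<rho> $ i $ j) * fv_field \<Delta>x \<rho> \<gamma> $ i $ j)
     = s j * (if j = Min UNIV then L else F (prev_cell j) j)
       - s j * (if j = Max UNIV then R else F j (next_cell j))" for j
    using assms[of i j] by (simp add: fv_field_def s_def F_def L_def R_def field_simps)
  have in': "(\<Sum>j\<in>UNIV. s j * (if j = Min UNIV then L else F (prev_cell j) j))
     = s (Min UNIV) * L + (\<Sum>j\<in>UNIV - {Max UNIV}. s (next_cell j) * F j (next_cell j))"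
    by (subst sum.remove[of _ "Min UNIV"])
       (auto simp flip: sum_shift_cells[of "\<lambda>j k. s k * F j k"] intro!: sum.cong)
  have out': "(\<Sum>j\<in>UNIV. s j * (if j = Max UNIV then R else F j (next_cell j)))
     = s (Max UNIV) * R + (\<Sum>j\<in>UNIV - {Max UNIV}. s j * F j (next_cell j))"
    by (subst sum.remove[of _ "Max UNIV"]) (auto intro!: sum.cong)
  have "(\<Sum>j\<in>UNIV. \<Delta>x i j * (sgn (\<rho> $ i $ j) * fv_field \<Delta>x \<rho> \<gamma> $ i $ j))
     = s (Min UNIV) * L - s (Max UNIV) * R
       + (\<Sum>j\<in>UNIV - {Max UNIV}. (s (next_cell j) - s j) * F j (next_cell j))"
    unfolding eq sum_subtractf in' out' by (simp add: sum_subtractf left_diff_distrib)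
  also have "\<dots> \<le> s (Min UNIV) * L - s (Max UNIV) * R"
    using sum_nonpos[of "UNIV - {Max UNIV}" "\<lambda>j. (s (next_cell j) - s j) * F j (next_cell j)"]
      num_flux_dissipative by (simp add: s_def F_def)
  also have "\<dots> \<le> \<bar>L\<bar> + \<bar>R\<bar>"
    by (auto simp: s_def sgn_real_def)
  finally show "(\<Sum>j\<in>UNIV. \<Delta>x i j * (sgn (\<rho> $ i $ j) * fv_field \<Delta>x \<rho> \<gamma> $ i $ j))
    \<le> \<bar>fst \<gamma> $ i\<bar> + \<bar>snd \<gamma> $ i\<bar>" by (simp add: L_def R_def)
qed

lemma norm_matrix_le_sum:
  fixes x :: "real ^ 'c ^ 'r"
  shows "norm x \<le> (\<Sum>i\<in>UNIV. \<Sum>j\<in>UNIV. \<bar>x $ i $ j\<bar>)"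
proof -
  have "norm x \<le> (\<Sum>i\<in>UNIV. norm (x $ i))"
    unfolding norm_vec_def by (rule L2_set_le_sum) simp
  also have "\<dots> \<le> (\<Sum>i\<in>UNIV. \<Sum>j\<in>UNIV. \<bar>x $ i $ j\<bar>)"
    by (intro sum_mono norm_le_l1_cart)
  finally show ?thesis .
qed

lemma matrix_entry_le_norm:
  fixes x :: "real ^ 'c ^ 'r"
  shows "\<bar>x $ i $ j\<bar> \<le> norm x"
  by (rule order_trans[OF component_le_norm_cart Finite_Cartesian_Product.norm_nth_le])

lemma fv_field_lipschitz:
  fixes \<rho> \<rho>' :: "('c::{finite,linorder}, 'r::finite) densities"
  assumes pos: "\<And>i j. 0 < \<Delta>x i j"
    and R: "\<And>i j. \<bar>\<rho> $ i $ j\<bar> \<le> R" "\<And>i j. \<bar>\<rho>' $ i $ j\<bar> \<le> R"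
  shows "norm (fv_field \<Delta>x \<rho> \<gamma> - fv_field \<Delta>x \<rho>' \<gamma>')
    \<le> (\<Sum>i\<in>UNIV. \<Sum>j\<in>UNIV. 1 / \<Delta>x i j) * (4 * (1 + 4 * R) * norm (\<rho> - \<rho>') + 2 * norm (\<gamma> - \<gamma>'))"
proof -
  define n where "n = norm (\<rho> - \<rho>')"
  define g where "g = norm (\<gamma> - \<gamma>')"
  have R0: "0 \<le> R" using R(1) abs_ge_zero order_trans by blast
  have n: "\<bar>\<rho> $ i $ j - \<rho>' $ i $ j\<bar> \<le> n" for i j
    using matrix_entry_le_norm[of "\<rho> - \<rho>'" i j] by (simp add: n_def)
  have nf: "\<bar>num_flux (\<rho> $ i $ j) (\<rho> $ i $ k) - num_flux (\<rho>' $ i $ j) (\<rho>' $ i $ k)\<bar>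
      \<le> 2 * (1 + 4 * R) * n + g" for i j k
  proof -
    have "\<bar>num_flux (\<rho> $ i $ j) (\<rho> $ i $ k) - num_flux (\<rho>' $ i $ j) (\<rho>' $ i $ k)\<bar>
       \<le> (1 + 4 * R) * (\<bar>\<rho> $ i $ j - \<rho>' $ i $ j\<bar> + \<bar>\<rho> $ i $ k - \<rho>' $ i $ k\<bar>)"
      by (rule num_flux_lipschitz) (rule R)+
    also have "\<dots> \<le> (1 + 4 * R) * (n + n)"
      using R0 n by (intro mult_left_mono add_mono) auto
    also have "\<dots> = 2 * (1 + 4 * R) * n" by simp
    finally show ?thesis using norm_ge_zero[of "\<gamma> - \<gamma>'"] unfolding g_def by linarith
  qed
  have f1: "\<bar>fst \<gamma> $ i - fst \<gamma>' $ i\<bar> \<le> 2 * (1 + 4 * R) * n + g" for i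
  proof -
    have "\<bar>(fst (\<gamma> - \<gamma>')) $ i\<bar> \<le> norm (fst (\<gamma> - \<gamma>'))" by (rule component_le_norm_cart)
    also have "\<dots> \<le> g" unfolding g_def using norm_fst_le[of "fst (\<gamma> - \<gamma>')" "snd (\<gamma> - \<gamma>')"] by (simp only: prod.collapse)
    finally show ?thesis using R0 by (simp add: n_def add_increasing)
  qed
  have f2: "\<bar>snd \<gamma> $ i - snd \<gamma>' $ i\<bar> \<le> 2 * (1 + 4 * R) * n + g" for i
  proof -
    have "\<bar>(snd (\<gamma> - \<gamma>')) $ i\<bar> \<le> norm (snd (\<gamma> - \<gamma>'))" by (rule component_le_norm_cart)
    also have "\<dots> \<le> g" unfolding g_def using norm_snd_le[of "snd (\<gamma> - \<gamma>')" "fst (\<gamma> - \<gamma>')"] by (simp only: prod.collapse)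
    finally show ?thesis using R0 by (simp add: n_def add_increasing)
  qed
  have comp: "\<bar>(fv_field \<Delta>x \<rho> \<gamma> - fv_field \<Delta>x \<rho>' \<gamma>') $ i $ j\<bar>
     \<le> 1 / \<Delta>x i j * (4 * (1 + 4 * R) * n + 2 * g)" for i j
  proof -
    define out where "out = (if j = Max UNIV then snd \<gamma> $ i else num_flux (\<rho> $ i $ j) (\<rho> $ i $ next_cell j))"
    define out' where "out' = (if j = Max UNIV then snd \<gamma>' $ i else num_flux (\<rho>' $ i $ j) (\<rho>' $ i $ next_cell j))"
    define inn where "inn = (if j = Min UNIV then fst \<gamma> $ i else num_flux (\<rho> $ i $ prev_cell j) (\<rho> $ i $ j))"
    define inn' where "inn' = (if j = Min UNIV then fst \<gamma>' $ i else num_flux (\<rho>' $ i $ prev_cell j) (\<rho>' $ i $ j))"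
    have "\<bar>out - out'\<bar> \<le> 2 * (1 + 4 * R) * n + g" "\<bar>inn - inn'\<bar> \<le> 2 * (1 + 4 * R) * n + g"
      using nf f1 f2 by (auto simp: out_def out'_def inn_def inn'_def)
    then have b: "\<bar>(out - out') - (inn - inn')\<bar> \<le> 4 * (1 + 4 * R) * n + 2 * g" by linarith
    have "(fv_field \<Delta>x \<rho> \<gamma> - fv_field \<Delta>x \<rho>' \<gamma>') $ i $ j
       = - (1 / \<Delta>x i j) * (out - inn) - (- (1 / \<Delta>x i j) * (out' - inn'))"
      by (simp add: fv_field_def out_def out'_def inn_def inn'_def)
    also have "\<dots> = - (1 / \<Delta>x i j) * ((out - out') - (inn - inn'))"
      by (simp add: right_diff_distrib)
    finally have eq: "\<bar>(fv_field \<Delta>x \<rho> \<gamma> - fv_field \<Delta>x \<rho>' \<gamma>') $ i $ j\<bar>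
       = 1 / \<Delta>x i j * \<bar>(out - out') - (inn - inn')\<bar>"
      using pos[of i j] by (simp add: abs_mult)
    show ?thesis unfolding eq using b pos[of i j] by (intro mult_left_mono) auto
  qed
  have "norm (fv_field \<Delta>x \<rho> \<gamma> - fv_field \<Delta>x \<rho>' \<gamma>')
     \<le> (\<Sum>i\<in>UNIV. \<Sum>j\<in>UNIV. 1 / \<Delta>x i j * (4 * (1 + 4 * R) * n + 2 * g))"
    by (rule order_trans[OF norm_matrix_le_sum]) (intro sum_mono comp)
  also have "\<dots> = (\<Sum>i\<in>UNIV. \<Sum>j\<in>UNIV. 1 / \<Delta>x i j) * (4 * (1 + 4 * R) * n + 2 * g)"
    unfolding sum_distrib_right ..
  finally show ?thesis by (simp add: n_def g_def)
qed

section \<open>Projections onto the control box and truncation of densities\<close>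

text \<open>
  The nearest point projection onto the control box. Composing an admissible control
  with it changes the control on a null set only.
\<close>

definition clip :: "real ^ 'n \<Rightarrow> real ^ 'n::finite" where
  "clip w = (\<chi> i. max 0 (min 1 (w $ i)))"

lemma clip_in_control_box: "clip w \<in> control_box"
  by (simp add: clip_def control_box_def)

lemma clip_id: "w \<in> control_box \<Longrightarrow> clip w = w"
  by (simp add: clip_def control_box_def vec_eq_iff)

lemma clip_nonexpansive: "norm (clip w - clip w') \<le> norm (w - w')"
  by (rule norm_le_componentwise_cart) (auto simp: clip_def)

text \<open>
  Truncation of all densities to \<open>[-R,R]\<close>, for \<open>R \<ge> 0\<close>.
\<close>

definition trunc :: "real \<Rightarrow> real ^ 'c ^ 'r \<Rightarrow> real ^ 'c ^ 'r" where
  "trunc R x = (\<chi> i. \<chi> j. max (- R) (min R (x $ i $ j)))"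

lemma trunc_nth: "trunc R x $ i $ j = max (- R) (min R (x $ i $ j))"
  by (simp add: trunc_def)

lemma trunc_le: "0 \<le> R \<Longrightarrow> \<bar>trunc R x $ i $ j\<bar> \<le> R"
  by (auto simp: trunc_nth)

lemma trunc_id: "(\<And>i j. \<bar>x $ i $ j\<bar> \<le> R) \<Longrightarrow> trunc R x = x"
  by (simp add: vec_eq_iff trunc_nth abs_le_iff max_def min_def) (smt (verit))

lemma trunc_nonexpansive:
  fixes x y :: "real ^ 'c ^ 'r"
  shows "norm (trunc R x - trunc R y) \<le> norm (x - y)"
proof -
  have "norm ((trunc R x - trunc R y) $ i) \<le> norm ((x - y) $ i)" for i
    by (rule norm_le_componentwise_cart) (auto simp: trunc_def)
  then show ?thesis unfolding norm_vec_def[of "trunc R x - trunc R y"] norm_vec_def[of "x - y"]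
    by (intro L2_set_mono) auto
qed

lemma integral_vec_nth:
  fixes f :: "real \<Rightarrow> 'a::euclidean_space ^ 'n"
  assumes "f integrable_on S"
  shows "(\<lambda>t. f t $ i) integrable_on S" "integral S (\<lambda>t. f t $ i) = integral S f $ i"
  using integrable_linear[OF assms bounded_linear_vec_nth[of i]]
    integral_linear[OF assms bounded_linear_vec_nth[of i]] by (auto simp: o_def)

lemma zero_in_control_box: "0 \<in> control_box" by (simp add: control_box_def)

lemma control_box_norm_le: "w \<in> control_box \<Longrightarrow> norm (w :: 'r::finite controls) \<le> CARD('r)"
proof -
  assume w: "w \<in> control_box"
  have "norm w \<le> (\<Sum>i\<in>UNIV. \<bar>w $ i\<bar>)" by (rule norm_le_l1_cart)
  also have "\<dots> \<le> (\<Sum>i\<in>(UNIV::'r set). 1)"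
    using w by (intro sum_mono) (auto simp: control_box_def)
  finally show ?thesis by simp
qed

text \<open>
  Controls with values in the control box at every time, and not only at almost every time.
\<close>

definition boxed_controls :: "real \<Rightarrow> (real \<Rightarrow> 'r::finite controls) set" where
  "boxed_controls T = {u. u \<in> borel_measurable (lebesgue_on {0..T}) \<and> (\<forall>t. u t \<in> control_box)}"

section \<open>Well-posedness of the controlled system\<close>

text \<open>
  A network with a junction map that is Lipschitz with constant \<open>L\<close>. The initial density \<open>\<rho>0\<close> is
  arbitrary.
\<close>

locale controlled_network =
  fixes T :: real
    and \<Delta>x :: "'r::finite \<Rightarrow> 'c::{finite,linorder} \<Rightarrow> real"
    and \<phi> :: "('c, 'r) densities \<Rightarrow> 'r controls \<Rightarrow> 'r fluxes"
    and \<rho>0 :: "('c, 'r) densities"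
    and L :: real
  assumes T_pos: "0 < T"
    and \<Delta>x_pos: "\<And>i j. 0 < \<Delta>x i j"
    and \<phi>_lipschitz: "L-lipschitz_on (UNIV \<times> control_box) (\<lambda>(\<rho>, w). \<phi> \<rho> w)"
begin

text \<open>
  The right-hand side of the system, as a function of the density and of the control value.
\<close>

definition rhs :: "('c, 'r) densities \<Rightarrow> 'r controls \<Rightarrow> ('c, 'r) densities" where
  "rhs \<rho> w = fv_field \<Delta>x \<rho> (\<phi> \<rho> w)"

text \<open>
  The weighted \<open>l\<^sup>1\<close> norm of a density, which is the total mass if the density is nonnegative.
\<close>

definition mass :: "('c, 'r) densities \<Rightarrow> real" where
  "mass \<rho> = (\<Sum>i\<in>UNIV. \<Sum>j\<in>UNIV. \<Delta>x i j * \<bar>\<rho> $ i $ j\<bar>)"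

text \<open>
  Solutions of the system in which the density is truncated at level \<open>R\<close> in the right-hand side, in
  integral form. As long as such a solution is bounded by \<open>R\<close> in absolute value, it solves the original system.
\<close>

definition truncated_solution :: "real \<Rightarrow> (real \<Rightarrow> 'r controls) \<Rightarrow> (real \<Rightarrow> ('c, 'r) densities) \<Rightarrow> bool" where
  "truncated_solution R u x \<longleftrightarrow> continuous_on {0..T} x \<and>
     (\<forall>t\<in>{0..T}. x t = \<rho>0 + integral {0..t} (\<lambda>s. rhs (trunc R (x s)) (u s)))"

lemma L_nonneg: "0 \<le> L"
  using \<phi>_lipschitz by (rule lipschitz_on_nonneg)

lemma \<phi>_diff_le:
  assumes "w \<in> control_box" "w' \<in> control_box"
  shows "norm (\<phi> \<rho> w - \<phi> \<rho>' w') \<le> L * (norm (\<rho> - \<rho>') + norm (w - w'))"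
proof -
  have "norm (\<phi> \<rho> w - \<phi> \<rho>' w') \<le> L * norm ((\<rho>, w) - (\<rho>', w'))"
    using lipschitz_onD[OF \<phi>_lipschitz, of "(\<rho>, w)" "(\<rho>', w')"] assms by (simp add: dist_norm)
  also have "\<dots> \<le> L * (norm (\<rho> - \<rho>') + norm (w - w'))"
    using norm_Pair_le[of "\<rho> - \<rho>'" "w - w'"] L_nonneg by (intro mult_left_mono) auto
  finally show ?thesis .
qed

lemma rhs_lipschitz:
  assumes R: "0 \<le> R"
  obtains C where "0 < C"
    "\<And>\<rho> \<rho>' w w'. (\<And>i j. \<bar>\<rho> $ i $ j\<bar> \<le> R) \<Longrightarrow> (\<And>i j. \<bar>\<rho>' $ i $ j\<bar> \<le> R) \<Longrightarrow>
       w \<in> control_box \<Longrightarrow> w' \<in> control_box \<Longrightarrow>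
       norm (rhs \<rho> w - rhs \<rho>' w') \<le> C * (norm (\<rho> - \<rho>') + norm (w - w'))"
proof -
  define S where "S = (\<Sum>i\<in>UNIV. \<Sum>j\<in>UNIV. 1 / \<Delta>x i j)"
  have S: "0 \<le> S" unfolding S_def using \<Delta>x_pos by (intro sum_nonneg) (auto intro: less_imp_le)
  define C where "C = S * (4 * (1 + 4 * R) + 2 * L) + 1"
  have C0: "0 < C" using S R L_nonneg by (simp add: C_def add_nonneg_pos)
  show thesis
  proof (rule that[OF C0])
    fix \<rho> \<rho>' :: "('c, 'r) densities" and w w' :: "'r controls"
    assume \<rho>: "\<And>i j. \<bar>\<rho> $ i $ j\<bar> \<le> R" "\<And>i j. \<bar>\<rho>' $ i $ j\<bar> \<le> R"
      and w: "w \<in> control_box" "w' \<in> control_box"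
    define n where "n = norm (\<rho> - \<rho>')"
    define m where "m = norm (w - w')"
    have nm: "0 \<le> n" "0 \<le> m" by (simp_all add: n_def m_def)
    have "norm (rhs \<rho> w - rhs \<rho>' w')
        \<le> S * (4 * (1 + 4 * R) * n + 2 * norm (\<phi> \<rho> w - \<phi> \<rho>' w'))"
      unfolding rhs_def S_def n_def by (intro fv_field_lipschitz \<Delta>x_pos \<rho>)
    also have "\<dots> \<le> S * (4 * (1 + 4 * R) * n + 2 * (L * (n + m)))"
      using \<phi>_diff_le[OF w, of \<rho> \<rho>'] S unfolding n_def m_def by (intro mult_left_mono) auto
    also have "\<dots> \<le> S * ((4 * (1 + 4 * R) + 2 * L) * (n + m))"
      using S R nm by (intro mult_left_mono) (auto simp: algebra_simps)
    also have "\<dots> \<le> C * (n + m)"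
      using nm by (simp add: C_def algebra_simps)
    finally show "norm (rhs \<rho> w - rhs \<rho>' w') \<le> C * (norm (\<rho> - \<rho>') + norm (w - w'))"
      by (simp add: n_def m_def)
  qed
qed

lemma norm_le_mass:
  obtains k where "0 \<le> k" "\<And>\<rho>. norm \<rho> \<le> k * mass \<rho>"
proof -
  define k where "k = (\<Sum>i\<in>UNIV. \<Sum>j\<in>UNIV. 1 / \<Delta>x i j)"
  have inv0: "0 \<le> 1 / \<Delta>x i j" for i j using \<Delta>x_pos[of i j] by simp
  have k1: "1 / \<Delta>x i j \<le> k" for i j
  proof -
    have "1 / \<Delta>x i j \<le> (\<Sum>j\<in>UNIV. 1 / \<Delta>x i j)"
      using inv0 by (intro member_le_sum) auto
    also have "\<dots> \<le> k"
      unfolding k_def using inv0 by (intro member_le_sum sum_nonneg) (auto intro: sum_nonneg)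
    finally show ?thesis .
  qed
  show thesis
  proof (rule that[of k])
    show "0 \<le> k" unfolding k_def using inv0 by (intro sum_nonneg) auto
    fix \<rho> :: "('c, 'r) densities"
    have "norm \<rho> \<le> (\<Sum>i\<in>UNIV. \<Sum>j\<in>UNIV. \<bar>\<rho> $ i $ j\<bar>)" by (rule norm_matrix_le_sum)
    also have "\<dots> \<le> (\<Sum>i\<in>UNIV. \<Sum>j\<in>UNIV. k * (\<Delta>x i j * \<bar>\<rho> $ i $ j\<bar>))"
    proof (intro sum_mono)
      fix i j
      have "1 \<le> k * \<Delta>x i j" using k1[of i j] \<Delta>x_pos[of i j] by (simp add: field_simps)
      then have "1 * \<bar>\<rho> $ i $ j\<bar> \<le> k * \<Delta>x i j * \<bar>\<rho> $ i $ j\<bar>" by (intro mult_right_mono) auto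
      then show "\<bar>\<rho> $ i $ j\<bar> \<le> k * (\<Delta>x i j * \<bar>\<rho> $ i $ j\<bar>)" by (simp add: mult_ac)
    qed
    also have "\<dots> = k * mass \<rho>" by (simp add: mass_def sum_distrib_left)
    finally show "norm \<rho> \<le> k * mass \<rho>" .
  qed
qed

lemma mass_nonneg: "0 \<le> mass \<rho>"
  unfolding mass_def by (intro sum_nonneg mult_nonneg_nonneg less_imp_le[OF \<Delta>x_pos]) auto

lemma mass_trunc_le: "0 \<le> R \<Longrightarrow> mass (trunc R \<rho>) \<le> mass \<rho>"
  unfolding mass_def
  by (intro sum_mono mult_left_mono less_imp_le[OF \<Delta>x_pos]) (auto simp: trunc_nth)

text \<open>
  The production of mass along the truncated system grows at most linearly, with constants \<open>a\<close> and
  \<open>b\<close> that do not depend on the truncation level \<open>R\<close>: truncation preserves signs and does not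
  increase the mass, and the boundary fluxes have linear growth.
\<close>

lemma dissipation_growth:
  obtains a b where "0 \<le> a" "0 \<le> b"
    "\<And>R \<rho> w. 0 < R \<Longrightarrow> w \<in> control_box \<Longrightarrow>
      (\<Sum>i\<in>UNIV. \<Sum>j\<in>UNIV. \<Delta>x i j * (sgn (\<rho> $ i $ j) * rhs (trunc R \<rho>) w $ i $ j)) \<le> a + b * mass \<rho>"
proof -
  obtain k where k: "0 \<le> k" "\<And>\<rho>. norm \<rho> \<le> k * mass \<rho>" by (rule norm_le_mass) blast
  define c where "c = norm (\<phi> 0 0) + L * CARD('r)"
  define N where "N = 2 * real CARD('r)"
  show thesis
  proof (rule that[of "N * c" "N * (L * k)"])
    show "0 \<le> N * c" using L_nonneg by (simp add: c_def N_def)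
    show "0 \<le> N * (L * k)" using L_nonneg k by (simp add: N_def)
    fix R :: real and \<rho> :: "('c, 'r) densities" and w :: "'r controls" assume R: "0 < R" and w: "w \<in> control_box"
    define r where "r = trunc R \<rho>"
    define \<gamma> where "\<gamma> = \<phi> r w"
    have "norm \<gamma> \<le> norm (\<phi> 0 0) + norm (\<gamma> - \<phi> 0 0)"
      using norm_triangle_ineq[of "\<phi> 0 0" "\<gamma> - \<phi> 0 0"] by simp
    also have "norm (\<gamma> - \<phi> 0 0) \<le> L * (norm r + norm w)"
      using \<phi>_diff_le[OF w zero_in_control_box, of r 0] by (simp add: \<gamma>_def)
    also have "\<dots> \<le> L * (k * mass \<rho> + CARD('r))"
    proof (intro mult_left_mono add_mono L_nonneg control_box_norm_le w)
      have "norm r \<le> k * mass r" by (rule k)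
      also have "\<dots> \<le> k * mass \<rho>"
        unfolding r_def using k R by (intro mult_left_mono mass_trunc_le) auto
      finally show "norm r \<le> k * mass \<rho>" .
    qed
    finally have \<gamma>: "norm \<gamma> \<le> c + L * k * mass \<rho>" by (simp add: c_def algebra_simps)
    have sg: "sgn (r $ i $ j) = sgn (\<rho> $ i $ j)" for i j
      using R by (auto simp: r_def trunc_nth sgn_real_def)
    have "(\<Sum>i\<in>UNIV. \<Sum>j\<in>UNIV. \<Delta>x i j * (sgn (\<rho> $ i $ j) * rhs (trunc R \<rho>) w $ i $ j))
      = (\<Sum>i\<in>UNIV. \<Sum>j\<in>UNIV. \<Delta>x i j * (sgn (r $ i $ j) * fv_field \<Delta>x r \<gamma> $ i $ j))"
      by (simp only: sg rhs_def \<gamma>_def flip: r_def)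
    also have "\<dots> \<le> (\<Sum>i\<in>UNIV. \<bar>fst \<gamma> $ i\<bar> + \<bar>snd \<gamma> $ i\<bar>)"
      by (rule fv_field_dissipation[OF \<Delta>x_pos])
    also have "\<dots> \<le> (\<Sum>i\<in>(UNIV::'r set). 2 * norm \<gamma>)"
    proof (rule sum_mono)
      fix i
      have "\<bar>fst \<gamma> $ i\<bar> \<le> norm \<gamma>"
        using component_le_norm_cart[of "fst \<gamma>" i] norm_fst_le[of "fst \<gamma>" "snd \<gamma>"] by simp
      moreover have "\<bar>snd \<gamma> $ i\<bar> \<le> norm \<gamma>"
        using component_le_norm_cart[of "snd \<gamma>" i] norm_snd_le[of "snd \<gamma>" "fst \<gamma>"] by simp
      ultimately show "\<bar>fst \<gamma> $ i\<bar> + \<bar>snd \<gamma> $ i\<bar> \<le> 2 * norm \<gamma>" by simp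
    qed
    also have "\<dots> = N * norm \<gamma>" by (simp add: N_def)
    also have "\<dots> \<le> N * (c + L * k * mass \<rho>)" using \<gamma> by (intro mult_left_mono) (auto simp: N_def)
    finally show "(\<Sum>i\<in>UNIV. \<Sum>j\<in>UNIV. \<Delta>x i j * (sgn (\<rho> $ i $ j) * rhs (trunc R \<rho>) w $ i $ j))
        \<le> N * c + N * (L * k) * mass \<rho>" by (simp add: algebra_simps)
  qed
qed

lemma rhs_trunc_lipschitz:
  assumes R: "0 \<le> R"
  obtains C where "0 < C"
    "\<And>\<rho> \<rho>' w w'. w \<in> control_box \<Longrightarrow> w' \<in> control_box \<Longrightarrow>
       norm (rhs (trunc R \<rho>) w - rhs (trunc R \<rho>') w') \<le> C * (norm (\<rho> - \<rho>') + norm (w - w'))"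
proof -
  obtain C where C: "0 < C" and le: "\<And>\<rho> \<rho>' w w'. (\<And>i j. \<bar>\<rho> $ i $ j\<bar> \<le> R) \<Longrightarrow> (\<And>i j. \<bar>\<rho>' $ i $ j\<bar> \<le> R) \<Longrightarrow>
       w \<in> control_box \<Longrightarrow> w' \<in> control_box \<Longrightarrow>
       norm (rhs \<rho> w - rhs \<rho>' w') \<le> C * (norm (\<rho> - \<rho>') + norm (w - w'))"
    by (rule rhs_lipschitz[OF R]) blast
  show thesis
  proof (rule that[OF C])
    fix \<rho> \<rho>' :: "('c, 'r) densities" and w w' :: "'r controls" assume "w \<in> control_box" "w' \<in> control_box"
    then have "norm (rhs (trunc R \<rho>) w - rhs (trunc R \<rho>') w')
      \<le> C * (norm (trunc R \<rho> - trunc R \<rho>') + norm (w - w'))"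
      by (intro le trunc_le R)
    also have "\<dots> \<le> C * (norm (\<rho> - \<rho>') + norm (w - w'))"
      using C by (intro mult_left_mono add_mono trunc_nonexpansive) auto
    finally show "norm (rhs (trunc R \<rho>) w - rhs (trunc R \<rho>') w') \<le> C * (norm (\<rho> - \<rho>') + norm (w - w'))" .
  qed
qed

lemma rhs_trunc_bounded:
  assumes R: "0 \<le> R"
  obtains K where "\<And>\<rho> w. w \<in> control_box \<Longrightarrow> norm (rhs (trunc R \<rho>) w) \<le> K"
proof -
  obtain C where C: "0 < C" and le: "\<And>\<rho> \<rho>' w w'. w \<in> control_box \<Longrightarrow> w' \<in> control_box \<Longrightarrow>
       norm (rhs (trunc R \<rho>) w - rhs (trunc R \<rho>') w') \<le> C * (norm (\<rho> - \<rho>') + norm (w - w'))"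
    by (rule rhs_trunc_lipschitz[OF R]) blast
  define K where "K = norm (rhs (trunc R 0) 0) + C * ((\<Sum>i\<in>(UNIV::'r set). \<Sum>j\<in>(UNIV::'c set). R) + CARD('r))"
  show thesis
  proof (rule that[of K])
    fix \<rho> :: "('c, 'r) densities" and w :: "'r controls" assume w: "w \<in> control_box"
    have tt: "trunc R (trunc R \<rho>) = trunc R \<rho>" by (intro trunc_id trunc_le R)
    have nr: "norm (trunc R \<rho>) \<le> (\<Sum>i\<in>(UNIV::'r set). \<Sum>j\<in>(UNIV::'c set). R)"
      by (rule order_trans[OF norm_matrix_le_sum]) (intro sum_mono trunc_le R)
    have "norm (rhs (trunc R \<rho>) w) \<le> norm (rhs (trunc R 0) 0)
        + norm (rhs (trunc R (trunc R \<rho>)) w - rhs (trunc R 0) 0)"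
      unfolding tt using norm_triangle_ineq[of "rhs (trunc R 0) 0" "rhs (trunc R \<rho>) w - rhs (trunc R 0) 0"]
      by simp
    also have "\<dots> \<le> norm (rhs (trunc R 0) 0) + C * (norm (trunc R \<rho> - 0) + norm (w - 0))"
      by (intro add_left_mono le w zero_in_control_box)
    also have "\<dots> \<le> K"
      unfolding K_def using nr control_box_norm_le[OF w] C by (intro add_left_mono mult_left_mono) auto
    finally show "norm (rhs (trunc R \<rho>) w) \<le> K" .
  qed
qed

lemma rhs_trunc_measurable:
  assumes R: "0 \<le> R" and x: "continuous_on {0..T} x" and u: "u \<in> boxed_controls T"
  shows "(\<lambda>s. rhs (trunc R (x s)) (u s)) \<in> borel_measurable (lebesgue_on {0..T})"
proof -
  obtain C where C: "0 < C" and le: "\<And>\<rho> \<rho>' w w'. w \<in> control_box \<Longrightarrow> w' \<in> control_box \<Longrightarrow>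
       norm (rhs (trunc R \<rho>) w - rhs (trunc R \<rho>') w') \<le> C * (norm (\<rho> - \<rho>') + norm (w - w'))"
    by (rule rhs_trunc_lipschitz[OF R]) blast
  define \<Psi> where "\<Psi> p = rhs (trunc R (fst p)) (clip (snd p))" for p
  have "(2 * C)-lipschitz_on UNIV \<Psi>"
  proof (rule lipschitz_onI)
    fix p q
    have "dist (\<Psi> p) (\<Psi> q) \<le> C * (norm (fst p - fst q) + norm (clip (snd p) - clip (snd q)))"
      unfolding dist_norm \<Psi>_def by (intro le clip_in_control_box)
    also have "\<dots> \<le> C * (dist p q + dist p q)"
    proof (intro mult_left_mono add_mono)
      show "norm (fst p - fst q) \<le> dist p q"
        using norm_fst_le[of "fst (p - q)" "snd (p - q)"] by (simp only: prod.collapse dist_norm flip: fst_diff)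
      show "norm (clip (snd p) - clip (snd q)) \<le> dist p q"
      proof -
        have "norm (snd (p - q)) \<le> dist p q"
          using norm_snd_le[of "snd (p - q)" "fst (p - q)"] by (simp only: prod.collapse dist_norm)
        with clip_nonexpansive[of "snd p" "snd q"] show ?thesis by simp
      qed
    qed (use C in simp)
    finally show "dist (\<Psi> p) (\<Psi> q) \<le> 2 * C * dist p q" by simp
  qed (use C in simp)
  then have \<Psi>: "continuous_on UNIV \<Psi>" by (rule lipschitz_on_continuous_on)
  have "(\<lambda>s. (x s, u s)) \<in> borel_measurable (lebesgue_on {0..T})"
  proof (rule borel_measurable_Pair)
    show "x \<in> borel_measurable (lebesgue_on {0..T})"
      using x by (rule continuous_imp_measurable_on_sets_lebesgue) simp
    show "u \<in> borel_measurable (lebesgue_on {0..T})" using u by (simp add: boxed_controls_def)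
  qed
  then have "(\<lambda>s. \<Psi> (x s, u s)) \<in> borel_measurable (lebesgue_on {0..T})"
    by (rule borel_measurable_continuous_on[OF \<Psi>])
  moreover have "\<Psi> (x s, u s) = rhs (trunc R (x s)) (u s)" for s
    using u by (simp add: \<Psi>_def clip_id boxed_controls_def)
  ultimately show ?thesis by simp
qed

lemma rhs_trunc_absolutely_integrable:
  assumes R: "0 \<le> R" and x: "continuous_on {0..T} x" and u: "u \<in> boxed_controls T"
    and ab: "{a..b} \<subseteq> {0..T}"
  shows "(\<lambda>s. rhs (trunc R (x s)) (u s)) absolutely_integrable_on {a..b}"
proof -
  obtain K where K: "\<And>\<rho> w. w \<in> control_box \<Longrightarrow> norm (rhs (trunc R \<rho>) w) \<le> K"
    by (rule rhs_trunc_bounded[OF R]) blast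
  show ?thesis
    by (rule bounded_measurable_absolutely_integrable[where K=K,
          OF borel_measurable_lebesgue_on_subinterval[OF rhs_trunc_measurable[OF R x u] ab]])
       (use K u in \<open>auto simp: boxed_controls_def\<close>)
qed

lemmas rhs_trunc_integrable =
  set_lebesgue_integral_eq_integral(1)[OF rhs_trunc_absolutely_integrable]

lemma truncated_solution_exists:
  assumes R: "0 \<le> R" and u: "u \<in> boxed_controls T"
  obtains x where "truncated_solution R u x"
proof -
  have ub: "u t \<in> control_box" for t using u by (simp add: boxed_controls_def)
  obtain K where K: "\<And>\<rho> w. w \<in> control_box \<Longrightarrow> norm (rhs (trunc R \<rho>) w) \<le> K"
    by (rule rhs_trunc_bounded[OF R]) blast
  obtain C where C: "0 < C" and le: "\<And>\<rho> \<rho>' w w'. w \<in> control_box \<Longrightarrow> w' \<in> control_box \<Longrightarrow>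
       norm (rhs (trunc R \<rho>) w - rhs (trunc R \<rho>') w') \<le> C * (norm (\<rho> - \<rho>') + norm (w - w'))"
    by (rule rhs_trunc_lipschitz[OF R]) blast
  have le': "norm (rhs (trunc R \<rho>) (u s) - rhs (trunc R \<rho>') (u s)) \<le> C * norm (\<rho> - \<rho>')" for s \<rho> \<rho>'
    using le[OF ub ub, of \<rho> s \<rho>' s] by simp
  have T0: "0 \<le> T" using T_pos by simp
  obtain x where xc: "continuous_on {0..T} x"
    and xe: "\<And>t. t \<in> {0..T} \<Longrightarrow> x t = \<rho>0 + integral {0..t} (\<lambda>s. rhs (trunc R (x s)) (u s))"
    by (rule caratheodory_existence[where G="\<lambda>s \<rho>. rhs (trunc R \<rho>) (u s)" and ?x0.0="\<rho>0",
          OF T0 rhs_trunc_measurable[OF R _ u] K[OF ub] le' C]) blast+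
  have "truncated_solution R u x" unfolding truncated_solution_def using xc xe by blast
  then show thesis by (rule that)
qed

text \<open>
  The a priori bound: the mass satisfies Gronwall's inequality. The bound \<open>B\<close> is uniform in the
  truncation level and in the control.
\<close>

lemma truncated_solution_bound:
  obtains B where "0 \<le> B"
    "\<And>R u x t i j. 0 < R \<Longrightarrow> u \<in> boxed_controls T \<Longrightarrow> truncated_solution R u x \<Longrightarrow>
       t \<in> {0..T} \<Longrightarrow> \<bar>x t $ i $ j\<bar> \<le> B"
proof -
  obtain a b where a: "0 \<le> a" and b: "0 \<le> b" and growth:
    "\<And>R \<rho> w. 0 < R \<Longrightarrow> w \<in> control_box \<Longrightarrow>
      (\<Sum>i\<in>UNIV. \<Sum>j\<in>UNIV. \<Delta>x i j * (sgn (\<rho> $ i $ j) * rhs (trunc R \<rho>) w $ i $ j)) \<le> a + b * mass \<rho>"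
    by (rule dissipation_growth) blast
  obtain k where k: "0 \<le> k" "\<And>\<rho>. norm \<rho> \<le> k * mass \<rho>" by (rule norm_le_mass) blast
  define B where "B = k * ((mass \<rho>0 + a * T) * exp (b * T))"
  show thesis
  proof (rule that[of B])
    show "0 \<le> B" unfolding B_def using k a T_pos mass_nonneg by (intro mult_nonneg_nonneg add_nonneg_nonneg) auto
    fix R :: real and u :: "real \<Rightarrow> 'r controls" and x :: "real \<Rightarrow> ('c, 'r) densities" and t :: real and i j
    assume R: "0 < R" and u: "u \<in> boxed_controls T" and sol: "truncated_solution R u x"
      and t: "t \<in> {0..T}"
    have R0: "0 \<le> R" using R by simp
    have xc: "continuous_on {0..T} x" using sol by (simp add: truncated_solution_def)
    define g where "g s = rhs (trunc R (x s)) (u s)" for s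
    have gm: "g \<in> borel_measurable (lebesgue_on {0..T})"
      unfolding g_def by (rule rhs_trunc_measurable[OF R0 xc u])
    obtain K where K: "\<And>\<rho> w. w \<in> control_box \<Longrightarrow> norm (rhs (trunc R \<rho>) w) \<le> K"
      by (rule rhs_trunc_bounded[OF R0]) blast
    have gK: "norm (g s) \<le> K" for s
      unfolding g_def using u by (intro K) (simp add: boxed_controls_def)
    have gi: "g integrable_on {0..s}" if "s \<in> {0..T}" for s
      unfolding g_def using that by (intro rhs_trunc_integrable R0 xc u) auto
    have gcm: "(\<lambda>s. g s $ i $ j) \<in> borel_measurable (lebesgue_on {0..s})" if "s \<in> {0..T}" for i j s
      by (rule borel_measurable_lebesgue_on_subinterval[OF
            borel_measurable_continuous_on[OF _ gm, where f="\<lambda>v. v $ i $ j"]])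
         (use that in \<open>auto intro!: continuous_intros\<close>)
    have gcK: "\<bar>g s $ i $ j\<bar> \<le> K" for s i j by (rule order_trans[OF matrix_entry_le_norm gK])
    have xcomp: "x s $ i $ j = \<rho>0 $ i $ j + integral {0..s} (\<lambda>s. g s $ i $ j)" if s: "s \<in> {0..T}" for s i j
    proof -
      have "x s = \<rho>0 + integral {0..s} g"
        using sol s by (simp add: truncated_solution_def g_def[abs_def])
      then show ?thesis
        using integral_vec_nth(2)[OF gi[OF s], of i]
          integral_vec_nth(2)[OF integral_vec_nth(1)[OF gi[OF s], of i], of j] by simp
    qed
    have sgm: "(\<lambda>r. sgn (x r $ i $ j) * g r $ i $ j) \<in> borel_measurable (lebesgue_on {0..s})"
      if "s \<in> {0..T}" for i j s
    proof (intro borel_measurable_times gcm that)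
      have "(\<lambda>r. x r $ i $ j) \<in> borel_measurable (lebesgue_on {0..s})"
        using that by (intro continuous_imp_measurable_on_sets_lebesgue continuous_intros
            continuous_on_subset[OF xc]) auto
      then show "(\<lambda>r. sgn (x r $ i $ j)) \<in> borel_measurable (lebesgue_on {0..s})"
        unfolding sgn_real_def by measurable
    qed
    have sgi: "(\<lambda>r. sgn (x r $ i $ j) * g r $ i $ j) integrable_on {0..s}" if "s \<in> {0..T}" for i j s
    proof (rule bounded_measurable_integrable[OF sgm[OF that], where K=K])
      fix r
      show "norm (sgn (x r $ i $ j) * g r $ i $ j) \<le> K"
        using gcK[of r i j] order_trans[OF abs_ge_zero gcK[of r i j]]
        by (simp add: abs_mult sgn_real_def)
    qed
    have massc: "continuous_on {0..T} (\<lambda>s. mass (x s))"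
      unfolding mass_def by (intro continuous_intros xc)
    have le: "mass (x s) \<le> (mass \<rho>0 + a * T) + b * integral {0..s} (\<lambda>s. mass (x s))"
      if s: "s \<in> {0..T}" for s
    proof -
      have "mass (x s) = (\<Sum>i\<in>UNIV. \<Sum>j\<in>UNIV. \<Delta>x i j *
          (\<bar>\<rho>0 $ i $ j\<bar> + integral {0..s} (\<lambda>r. sgn (x r $ i $ j) * g r $ i $ j)))"
        unfolding mass_def
      proof (intro sum.cong refl arg_cong2[where f="(*)"])
        fix i j
        show "\<bar>x s $ i $ j\<bar> = \<bar>\<rho>0 $ i $ j\<bar> + integral {0..s} (\<lambda>r. sgn (x r $ i $ j) * g r $ i $ j)"
          by (rule abs_chain_rule[OF gcm[OF s] gcK]) (use s xcomp in auto)
      qed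
      also have "\<dots> = mass \<rho>0 + (\<Sum>i\<in>UNIV. \<Sum>j\<in>UNIV.
          integral {0..s} (\<lambda>r. \<Delta>x i j * (sgn (x r $ i $ j) * g r $ i $ j)))"
        by (simp add: mass_def distrib_left sum.distrib)
      also have "(\<Sum>i\<in>UNIV. \<Sum>j\<in>UNIV.
          integral {0..s} (\<lambda>r. \<Delta>x i j * (sgn (x r $ i $ j) * g r $ i $ j)))
          = integral {0..s} (\<lambda>r. \<Sum>i\<in>UNIV. \<Sum>j\<in>UNIV. \<Delta>x i j * (sgn (x r $ i $ j) * g r $ i $ j))"
      proof -
        have si: "(\<lambda>r. \<Delta>x i j * (sgn (x r $ i $ j) * g r $ i $ j)) integrable_on {0..s}" for i j
          by (intro integrable_on_mult_right sgi s)
        show ?thesis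
          by (subst integral_sum) (auto simp: integral_sum si intro!: integrable_sum si)
      qed
      also have "\<dots> \<le> integral {0..s} (\<lambda>r. a + b * mass (x r))"
      proof (rule integral_le)
        show "(\<lambda>r. \<Sum>i\<in>UNIV. \<Sum>j\<in>UNIV. \<Delta>x i j * (sgn (x r $ i $ j) * g r $ i $ j)) integrable_on {0..s}"
          by (auto intro!: integrable_sum integrable_on_mult_right sgi s)
        show "(\<lambda>r. a + b * mass (x r)) integrable_on {0..s}"
          using s by (intro integrable_continuous_real continuous_intros continuous_on_subset[OF massc]) auto
        fix r
        show "(\<Sum>i\<in>UNIV. \<Sum>j\<in>UNIV. \<Delta>x i j * (sgn (x r $ i $ j) * g r $ i $ j)) \<le> a + b * mass (x r)"
          unfolding g_def using u R by (intro growth) (auto simp: boxed_controls_def)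
      qed
      also have "\<dots> = a * s + b * integral {0..s} (\<lambda>r. mass (x r))"
      proof -
        have "(\<lambda>r. mass (x r)) integrable_on {0..s}"
          using s by (intro integrable_continuous_real continuous_on_subset[OF massc]) auto
        then show ?thesis using s
          by (subst integral_add) (auto intro!: integrable_on_mult_right)
      qed
      also have "mass \<rho>0 + (a * s + b * integral {0..s} (\<lambda>r. mass (x r)))
         \<le> (mass \<rho>0 + a * T) + b * integral {0..s} (\<lambda>s. mass (x s))"
        using s a by (simp add: mult_left_mono)
      finally show ?thesis by simp
    qed
    have "mass (x t) \<le> (mass \<rho>0 + a * T) * exp (b * t)"
      by (rule gronwall[OF massc b le t])
    also have "\<dots> \<le> (mass \<rho>0 + a * T) * exp (b * T)"
      using t a b T_pos mass_nonneg by (intro mult_left_mono add_nonneg_nonneg) (auto simp: mult_left_mono)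
    finally have "k * mass (x t) \<le> B" unfolding B_def using k by (intro mult_left_mono) auto
    with k(2)[of "x t"] matrix_entry_le_norm[of "x t" i j] show "\<bar>x t $ i $ j\<bar> \<le> B" by linarith
  qed
qed

lemma truncated_solution_change:
  assumes "truncated_solution R u x" "\<And>t i j. t \<in> {0..T} \<Longrightarrow> \<bar>x t $ i $ j\<bar> \<le> min R R'"
  shows "truncated_solution R' u x"
proof -
  have "trunc R (x s) = trunc R' (x s)" if "s \<in> {0..T}" for s
    using assms(2)[OF that] by (simp add: trunc_id)
  then have "integral {0..t} (\<lambda>s. rhs (trunc R (x s)) (u s)) = integral {0..t} (\<lambda>s. rhs (trunc R' (x s)) (u s))"
    if "t \<in> {0..T}" for t
    using that by (intro integral_cong) auto
  then show ?thesis using assms(1) by (simp add: truncated_solution_def)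
qed

text \<open>
  A solution is continuous, hence bounded, hence a solution of some truncated system.
\<close>

lemma is_solution_imp_truncated:
  assumes u: "u \<in> boxed_controls T" and sol: "is_solution T \<Delta>x \<phi> \<rho>0 u x"
  obtains R where "0 < R" "truncated_solution R u x" "\<And>t i j. t \<in> {0..T} \<Longrightarrow> \<bar>x t $ i $ j\<bar> \<le> R"
proof -
  have xc: "continuous_on {0..T} x" using sol by (simp add: is_solution_def)
  have "bounded (x ` {0..T})" by (intro compact_imp_bounded compact_continuous_image xc) auto
  then obtain R where R: "\<And>t. t \<in> {0..T} \<Longrightarrow> norm (x t) \<le> R" "0 < R"
    unfolding bounded_pos by blast
  have xR: "\<bar>x t $ i $ j\<bar> \<le> R" if "t \<in> {0..T}" for t i j
    using matrix_entry_le_norm R(1)[OF that] by (rule order_trans)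
  have eq: "rhs (trunc R (x s)) (u s) = fv_field \<Delta>x (x s) (\<phi> (x s) (u s))" if "s \<in> {0..T}" for s
    using trunc_id[OF xR[OF that]] by (simp add: rhs_def)
  have "x t = \<rho>0 + integral {0..t} (\<lambda>s. rhs (trunc R (x s)) (u s))" if t: "t \<in> {0..T}" for t
  proof -
    have "x t = \<rho>0 + (LINT s:{0..t}|lebesgue. fv_field \<Delta>x (x s) (\<phi> (x s) (u s)))"
      using sol t by (simp add: is_solution_def)
    also have "(LINT s:{0..t}|lebesgue. fv_field \<Delta>x (x s) (\<phi> (x s) (u s)))
       = (LINT s:{0..t}|lebesgue. rhs (trunc R (x s)) (u s))"
      using t by (intro set_lebesgue_integral_cong) (auto simp: eq)
    also have "\<dots> = integral {0..t} (\<lambda>s. rhs (trunc R (x s)) (u s))"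
      using t R(2) by (intro set_lebesgue_integral_eq_integral(2) rhs_trunc_absolutely_integrable xc u) auto
    finally show ?thesis .
  qed
  then have "truncated_solution R u x" using xc by (simp add: truncated_solution_def)
  then show thesis using that R(2) xR by blast
qed

lemma truncated_imp_is_solution:
  assumes u: "u \<in> boxed_controls T" and R: "0 \<le> R" and sol: "truncated_solution R u x"
    and xR: "\<And>t i j. t \<in> {0..T} \<Longrightarrow> \<bar>x t $ i $ j\<bar> \<le> R"
  shows "is_solution T \<Delta>x \<phi> \<rho>0 u x"
  unfolding is_solution_def
proof (intro conjI ballI)
  show xc: "continuous_on {0..T} x" using sol by (simp add: truncated_solution_def)
  have eq: "rhs (trunc R (x s)) (u s) = fv_field \<Delta>x (x s) (\<phi> (x s) (u s))" if "s \<in> {0..T}" for s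
    using trunc_id[OF xR[OF that]] by (simp add: rhs_def)
  show "set_integrable lebesgue {0..T} (\<lambda>s. fv_field \<Delta>x (x s) (\<phi> (x s) (u s)))"
    by (rule absolutely_integrable_spike[OF rhs_trunc_absolutely_integrable[OF R xc u order_refl], of "{}"])
       (auto simp: eq)
  fix t assume t: "t \<in> {0..T}"
  have "(LINT s:{0..t}|lebesgue. fv_field \<Delta>x (x s) (\<phi> (x s) (u s)))
     = (LINT s:{0..t}|lebesgue. rhs (trunc R (x s)) (u s))"
    using t by (intro set_lebesgue_integral_cong) (auto simp: eq)
  also have "\<dots> = integral {0..t} (\<lambda>s. rhs (trunc R (x s)) (u s))"
    using t R by (intro set_lebesgue_integral_eq_integral(2) rhs_trunc_absolutely_integrable xc u) auto
  finally show "x t = \<rho>0 + (LINT s:{0..t}|lebesgue. fv_field \<Delta>x (x s) (\<phi> (x s) (u s)))"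
    using sol t by (simp add: truncated_solution_def)
qed

lemma truncated_solution_stability:
  assumes R: "0 \<le> R"
  obtains C where "0 < C"
    "\<And>u v x y t. u \<in> boxed_controls T \<Longrightarrow> v \<in> boxed_controls T \<Longrightarrow> truncated_solution R u x \<Longrightarrow>
      truncated_solution R v y \<Longrightarrow> t \<in> {0..T} \<Longrightarrow>
      norm (x t - y t) \<le> C * integral {0..T} (\<lambda>s. norm (u s - v s))"
proof -
  obtain C where C: "0 < C" and le: "\<And>\<rho> \<rho>' w w'. w \<in> control_box \<Longrightarrow> w' \<in> control_box \<Longrightarrow>
       norm (rhs (trunc R \<rho>) w - rhs (trunc R \<rho>') w') \<le> C * (norm (\<rho> - \<rho>') + norm (w - w'))"
    by (rule rhs_trunc_lipschitz[OF R]) blast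
  show thesis
  proof (rule that[of "C * exp (C * T)"])
    fix u v x y t
    assume u: "u \<in> boxed_controls T" and v: "v \<in> boxed_controls T"
      and x: "truncated_solution R u x" and y: "truncated_solution R v y" and t: "t \<in> {0..T}"
    have xc: "continuous_on {0..T} x" and yc: "continuous_on {0..T} y"
      using x y by (simp_all add: truncated_solution_def)
    define D where "D = integral {0..T} (\<lambda>s. norm (u s - v s))"
    have uvi: "(\<lambda>s. norm (u s - v s)) integrable_on {0..T}"
    proof (rule bounded_measurable_integrable[where K="2 * CARD('r)"])
      show "(\<lambda>s. norm (u s - v s)) \<in> borel_measurable (lebesgue_on {0..T})"
      proof -
        have [measurable]: "u \<in> borel_measurable (lebesgue_on {0..T})" "v \<in> borel_measurable (lebesgue_on {0..T})"
          using u v by (auto simp: boxed_controls_def)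
        show ?thesis by measurable
      qed
      fix s
      have "norm (u s) \<le> CARD('r)" "norm (v s) \<le> CARD('r)"
        using u v by (auto intro!: control_box_norm_le simp: boxed_controls_def)
      then show "norm (norm (u s - v s)) \<le> 2 * CARD('r)"
        using norm_triangle_ineq4[of "u s" "v s"] by simp
    qed
    have D0: "0 \<le> D" unfolding D_def by (intro integral_nonneg uvi) auto
    have wc: "continuous_on {0..T} (\<lambda>s. norm (x s - y s))" by (intro continuous_intros xc yc)
    have "norm (x t - y t) \<le> (C * D) * exp (C * t)"
    proof (rule gronwall[OF wc _ _ t])
      show "0 \<le> C" using C by simp
      fix s assume s: "s \<in> {0..T}"
      have fi: "(\<lambda>r. rhs (trunc R (x r)) (u r)) integrable_on {0..s}"
        "(\<lambda>r. rhs (trunc R (y r)) (v r)) integrable_on {0..s}"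
        using s by (intro rhs_trunc_integrable R xc yc u v; simp)+
      have wi: "(\<lambda>r. norm (x r - y r)) integrable_on {0..s}"
        using s by (intro integrable_continuous_real continuous_on_subset[OF wc]) auto
      have uvi': "(\<lambda>r. norm (u r - v r)) integrable_on {0..s}"
        using uvi by (rule integrable_on_subinterval) (use s in auto)
      have "x s - y s = integral {0..s} (\<lambda>r. rhs (trunc R (x r)) (u r)) - integral {0..s} (\<lambda>r. rhs (trunc R (y r)) (v r))"
        using x y s by (simp add: truncated_solution_def)
      also have "\<dots> = integral {0..s} (\<lambda>r. rhs (trunc R (x r)) (u r) - rhs (trunc R (y r)) (v r))"
        by (rule integral_diff[OF fi, symmetric])
      also have "norm \<dots> \<le> integral {0..s} (\<lambda>r. C * (norm (x r - y r) + norm (u r - v r)))"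
        by (intro integral_norm_bound_integral integrable_diff fi integrable_on_mult_right integrable_add wi uvi' le)
           (use u v in \<open>auto simp: boxed_controls_def\<close>)
      also have "\<dots> = C * integral {0..s} (\<lambda>r. norm (x r - y r)) + C * integral {0..s} (\<lambda>r. norm (u r - v r))"
        by (subst integral_mult_right, subst integral_add[OF wi uvi'], rule distrib_left)
      also have "\<dots> \<le> C * integral {0..s} (\<lambda>r. norm (x r - y r)) + C * D"
        unfolding D_def using s C
        by (intro add_left_mono mult_left_mono integral_subset_le uvi uvi') auto
      finally show "norm (x s - y s) \<le> C * D + C * integral {0..s} (\<lambda>r. norm (x r - y r))"
        by simp
    qed
    also have "\<dots> \<le> (C * D) * exp (C * T)"
      using C D0 t by (intro mult_left_mono) auto
    finally show "norm (x t - y t) \<le> C * exp (C * T) * integral {0..T} (\<lambda>s. norm (u s - v s))"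
      by (simp add: D_def mult_ac)
  qed (use C in simp)
qed

text \<open>
  All solutions, truncated or not, are bounded by \<open>B\<close> in absolute value, so the systems truncated at level \<open>R = B + 1\<close> and
  the original one have the same solutions. In particular solutions exist, and the chosen one is
  bounded uniformly and depends on the control in a Lipschitz way for the \<open>L\<^sup>1\<close> norm.
\<close>

lemma density_solution_bounded_stable:
  obtains B C where "0 \<le> B"
    "\<And>u i j. u \<in> boxed_controls T \<Longrightarrow> \<bar>density_solution T \<Delta>x \<phi> \<rho>0 u T $ i $ j\<bar> \<le> B"
    "\<And>u v. u \<in> boxed_controls T \<Longrightarrow> v \<in> boxed_controls T \<Longrightarrow>
      norm (density_solution T \<Delta>x \<phi> \<rho>0 u T - density_solution T \<Delta>x \<phi> \<rho>0 v T)
        \<le> C * integral {0..T} (\<lambda>s. norm (u s - v s))"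
proof -
  obtain B where B0: "0 \<le> B" and B:
    "\<And>R u x t i j. 0 < R \<Longrightarrow> u \<in> boxed_controls T \<Longrightarrow> truncated_solution R u x \<Longrightarrow>
       t \<in> {0..T} \<Longrightarrow> \<bar>x t $ i $ j\<bar> \<le> B"
    by (rule truncated_solution_bound) blast
  define R where "R = B + 1"
  have R: "0 < R" "0 \<le> R" "B \<le> R" using B0 by (auto simp: R_def)
  obtain C where C: "\<And>u v x y t. u \<in> boxed_controls T \<Longrightarrow> v \<in> boxed_controls T \<Longrightarrow> truncated_solution R u x \<Longrightarrow>
      truncated_solution R v y \<Longrightarrow> t \<in> {0..T} \<Longrightarrow>
      norm (x t - y t) \<le> C * integral {0..T} (\<lambda>s. norm (u s - v s))"
    by (rule truncated_solution_stability[OF R(2)]) blast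
  \<comment> \<open>A solution exists, so \<open>density_solution\<close> is one; a priori it solves some system truncated at
     \<open>R'\<close>, but the bound \<open>B\<close> is independent of \<open>R'\<close>.\<close>
  have sol: "truncated_solution R u (density_solution T \<Delta>x \<phi> \<rho>0 u)" if u: "u \<in> boxed_controls T" for u
  proof -
    obtain x where x: "truncated_solution R u x" using truncated_solution_exists[OF R(2) u] .
    have xR: "\<bar>x t $ i $ j\<bar> \<le> R" if "t \<in> {0..T}" for t i j
      using B[OF R(1) u x that] R(3) by (rule order_trans)
    have "is_solution T \<Delta>x \<phi> \<rho>0 u x"
      using truncated_imp_is_solution[OF u R(2) x] xR by blast
    then have sol0: "is_solution T \<Delta>x \<phi> \<rho>0 u (density_solution T \<Delta>x \<phi> \<rho>0 u)"
      unfolding density_solution_def by (rule someI[where P="is_solution T \<Delta>x \<phi> \<rho>0 u"])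
    obtain R' where R': "0 < R'" and sol': "truncated_solution R' u (density_solution T \<Delta>x \<phi> \<rho>0 u)"
      and bd: "\<And>t i j. t \<in> {0..T} \<Longrightarrow> \<bar>density_solution T \<Delta>x \<phi> \<rho>0 u t $ i $ j\<bar> \<le> R'"
      by (rule is_solution_imp_truncated[OF u sol0]) blast
    show ?thesis
      by (rule truncated_solution_change[OF sol'])
         (intro min.boundedI bd order_trans[OF B[OF R' u sol'] R(3)])
  qed
  have TT: "T \<in> {0..T}" using T_pos by simp
  show thesis
    by (rule that[OF B0 B[OF R(1) _ sol TT] C[OF _ _ sol sol TT]])
qed

end

section \<open>Modification of controls on null sets and continuity of the cost\<close>

lemma AE_lebesgue_on_imp_negligible:
  assumes "AE t in lebesgue_on S. P t" "S \<in> sets lebesgue"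
  obtains N where "negligible N" "\<And>t. t \<in> S - N \<Longrightarrow> P t"
proof -
  have "AE t in lebesgue. t \<in> S \<longrightarrow> P t"
    using assms by (simp add: AE_restrict_space_iff)
  then obtain N where "{t \<in> space lebesgue. \<not> (t \<in> S \<longrightarrow> P t)} \<subseteq> N" "emeasure lebesgue N = 0" "N \<in> sets lebesgue"
    by (rule AE_E)
  then have "negligible N" "\<And>t. t \<in> S - N \<Longrightarrow> P t"
    by (auto simp: negligible_iff_null_sets null_sets_def)
  then show thesis by (rule that)
qed

text \<open>
  No measurability is assumed: the Lebesgue measure is complete, so \<open>f\<close> and \<open>g\<close> are integrable
  together, and otherwise both integrals have the default value \<open>0\<close>. This matters because \<open>\<phi>\<close> is
  unconstrained at control values outside the box.
\<close>

lemma set_lebesgue_integral_spike: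
  fixes f g :: "'a::euclidean_space \<Rightarrow> 'b::euclidean_space"
  assumes N: "negligible N" and eq: "\<And>t. t \<in> S - N \<Longrightarrow> f t = g t"
  shows "set_integrable lebesgue S f \<longleftrightarrow> set_integrable lebesgue S g"
    and "(LINT t:S|lebesgue. f t) = (LINT t:S|lebesgue. g t)"
proof -
  show iff: "set_integrable lebesgue S f \<longleftrightarrow> set_integrable lebesgue S g"
    using N eq by (intro absolutely_integrable_spike_eq) auto
  show "(LINT t:S|lebesgue. f t) = (LINT t:S|lebesgue. g t)"
  proof (cases "set_integrable lebesgue S f")
    case True
    then show ?thesis
      using iff integral_spike[OF N, of S g f] eq by (simp add: set_lebesgue_integral_eq_integral(2))
  next
    case False
    then show ?thesis
      using iff by (simp add: set_lebesgue_integral_def set_integrable_def not_integrable_integral_eq)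
  qed
qed

lemma TV_nonneg: "0 \<le> TV T f"
proof -
  have "(\<lambda>_. 0) \<in> TV_test_functions T" by (simp add: TV_test_functions_def)
  then have "ereal (LINT t:{0..T}|lebesgue. f t * deriv (\<lambda>_. 0) t) \<le> TV T f"
    unfolding TV_def by (rule SUP_upper)
  then show ?thesis by (simp add: zero_ereal_def set_lebesgue_integral_def)
qed

text \<open>
  The derivative of a test function is continuous on the compact support and zero elsewhere.
\<close>

lemma TV_test_function_deriv:
  assumes "\<psi> \<in> TV_test_functions T"
  shows "deriv \<psi> \<in> borel_measurable borel" and "\<exists>B. \<forall>t. \<bar>deriv \<psi> t\<bar> \<le> B"
proof -
  define S where "S = closure {t. \<psi> t \<noteq> 0}"
  have sub: "S \<subseteq> {0<..<T}" using assms by (simp add: TV_test_functions_def S_def)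
  then have "bounded S" by (rule bounded_subset[rotated]) simp
  then have comp: "compact S" by (simp add: compact_eq_bounded_closed S_def)
  obtain D where D: "\<And>t. t \<in> {0<..<T} \<Longrightarrow> (\<psi> has_vector_derivative D t) (at t)"
    and Dc: "continuous_on {0<..<T} D"
    using assms unfolding TV_test_functions_def C1_differentiable_on_def by blast
  have D': "deriv \<psi> t = D t" if "t \<in> S" for t
    using D[of t] sub that
    by (auto intro!: DERIV_imp_deriv simp: has_real_derivative_iff_has_vector_derivative)
  have zero: "deriv \<psi> t = 0" if t: "t \<notin> S" for t
  proof (rule DERIV_imp_deriv)
    have const: "((\<lambda>_. 0) has_real_derivative 0) (at t)" by simp
    have "open (- S)" by (simp add: S_def open_Compl)
    moreover have "0 = \<psi> s" if "s \<in> - S" for s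
    proof -
      have "s \<notin> {t. \<psi> t \<noteq> 0}"
      proof
        assume "s \<in> {t. \<psi> t \<noteq> 0}"
        then have "s \<in> S" unfolding S_def by (rule subsetD[OF closure_subset])
        with ComplD[OF that] show False by contradiction
      qed
      then show ?thesis by (simp only: mem_Collect_eq not_not)
    qed
    ultimately show "(\<psi> has_real_derivative 0) (at t)"
      using t by (intro has_field_derivative_transform_within_open[OF const]) auto
  qed
  have DcS: "continuous_on S D" using Dc sub by (rule continuous_on_subset)
  have eq: "deriv \<psi> = (\<lambda>t. indicator S t *\<^sub>R D t)"
    using D' zero by (auto simp: indicator_def)
  show "deriv \<psi> \<in> borel_measurable borel"
    unfolding eq by (rule borel_measurable_continuous_on_indicator[OF _ DcS]) (simp add: S_def)
  have "bounded (D ` S)" by (intro compact_imp_bounded compact_continuous_image DcS comp)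
  then obtain B where B: "0 < B" "\<And>t. t \<in> S \<Longrightarrow> norm (D t) \<le> B" unfolding bounded_pos by blast
  then show "\<exists>B. \<forall>t. \<bar>deriv \<psi> t\<bar> \<le> B"
    by (intro exI[of _ B]) (auto simp: eq indicator_def)
qed

text \<open>
  The total variation is a supremum of functionals that are continuous under bounded convergence.
\<close>

lemma TV_lower_semicontinuous:
  fixes f :: "nat \<Rightarrow> real \<Rightarrow> real"
  assumes fm: "\<And>n. f n \<in> borel_measurable (lebesgue_on {0..T})"
    and gm: "g \<in> borel_measurable (lebesgue_on {0..T})"
    and F: "\<And>n t. \<bar>f n t\<bar> \<le> F" and G: "\<And>t. \<bar>g t\<bar> \<le> F"
    and N: "negligible N" and lim: "\<And>t. t \<in> {0..T} - N \<Longrightarrow> (\<lambda>n. f n t) \<longlonglongrightarrow> g t"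
    and V: "\<And>n. TV T (f n) \<le> ereal (c n)" and c: "c \<longlonglongrightarrow> c0"
  shows "TV T g \<le> ereal c0"
  unfolding TV_def
proof (rule SUP_least)
  fix \<psi> assume \<psi>: "\<psi> \<in> TV_test_functions T"
  obtain B where B: "\<And>t. \<bar>deriv \<psi> t\<bar> \<le> B" using TV_test_function_deriv(2)[OF \<psi>] by blast
  have dm: "deriv \<psi> \<in> borel_measurable (lebesgue_on {0..T})"
    using TV_test_function_deriv(1)[OF \<psi>] by (intro measurable_restrict_space1 measurable_completion) simp
  have hm: "(\<lambda>t. h t * deriv \<psi> t) \<in> borel_measurable (lebesgue_on {0..T})"
    if "h \<in> borel_measurable (lebesgue_on {0..T})" for h
    by (intro borel_measurable_times that dm)
  have hb: "\<bar>h t * deriv \<psi> t\<bar> \<le> F * B" if "\<bar>h t\<bar> \<le> F" for h t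
    unfolding abs_mult using that B[of t] order_trans[OF abs_ge_zero that] by (intro mult_mono) auto
  have eq: "(LINT t:{0..T}|lebesgue. h t * deriv \<psi> t) = integral {0..T} (\<lambda>t. h t * deriv \<psi> t)"
    if "h \<in> borel_measurable (lebesgue_on {0..T})" "\<And>t. \<bar>h t\<bar> \<le> F" for h
    using bounded_measurable_absolutely_integrable[OF hm[OF that(1)], of "F * B"] hb that(2)
    by (intro set_lebesgue_integral_eq_integral(2)) auto
  have "(\<lambda>n. LINT t:{0..T}|lebesgue. f n t * deriv \<psi> t) \<longlonglongrightarrow> (LINT t:{0..T}|lebesgue. g t * deriv \<psi> t)"
    unfolding eq[OF fm F] eq[OF gm G]
  proof (rule bounded_convergence_ae[where K="F * B", OF hm[OF fm] _ N])
    show "norm (f n t * deriv \<psi> t) \<le> F * B" for n t using hb[of "f n" t, OF F] by simp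
    show "(\<lambda>n. f n t * deriv \<psi> t) \<longlonglongrightarrow> g t * deriv \<psi> t" if "t \<in> {0..T} - N" for t
      by (intro tendsto_mult lim that tendsto_const)
  qed
  moreover have "(LINT t:{0..T}|lebesgue. f n t * deriv \<psi> t) \<le> c n" for n
  proof -
    have "ereal (LINT t:{0..T}|lebesgue. f n t * deriv \<psi> t) \<le> TV T (f n)"
      unfolding TV_def using \<psi> by (rule SUP_upper)
    also have "\<dots> \<le> ereal (c n)" by (rule V)
    finally show ?thesis by simp
  qed
  ultimately have "(LINT t:{0..T}|lebesgue. g t * deriv \<psi> t) \<le> c0"
    using c by (intro LIMSEQ_le) auto
  then show "ereal (LINT t:{0..T}|lebesgue. g t * deriv \<psi> t) \<le> ereal c0" by simp
qed

lemma boxed_controls_admissible: "u \<in> boxed_controls T \<Longrightarrow> u \<in> admissible_controls T"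
  by (simp add: boxed_controls_def admissible_controls_def)

lemma clip_boxed_control:
  assumes "u \<in> admissible_controls T"
  shows "(\<lambda>t. clip (u t)) \<in> boxed_controls T"
proof -
  have "continuous_on UNIV (clip :: real ^ 'n \<Rightarrow> real ^ 'n)"
    unfolding clip_def by (intro continuous_intros)
  then have "(\<lambda>t. clip (u t)) \<in> borel_measurable (lebesgue_on {0..T})"
    by (rule borel_measurable_continuous_on) (use assms in \<open>simp add: admissible_controls_def\<close>)
  then show ?thesis by (simp add: boxed_controls_def clip_in_control_box)
qed

lemma cost_J_clip:
  assumes "u \<in> admissible_controls T"
  shows "cost_J T \<Delta>x \<phi> \<rho>0 \<chi>path Nmax \<theta>S \<theta>B (\<lambda>t. clip (u t))
       = cost_J T \<Delta>x \<phi> \<rho>0 \<chi>path Nmax \<theta>S \<theta>B u"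
proof -
  have "AE t in lebesgue_on {0..T}. u t \<in> control_box"
    using assms by (simp add: admissible_controls_def)
  then obtain N where N: "negligible N" and box: "\<And>t. t \<in> {0..T} - N \<Longrightarrow> u t \<in> control_box"
    by (rule AE_lebesgue_on_imp_negligible) auto
  have eq: "clip (u t) = u t" if "t \<in> {0..T} - N" for t using box[OF that] by (rule clip_id)
  have "is_solution T \<Delta>x \<phi> \<rho>0 (\<lambda>t. clip (u t)) \<rho> \<longleftrightarrow> is_solution T \<Delta>x \<phi> \<rho>0 u \<rho>" for \<rho>
  proof -
    have 1: "set_integrable lebesgue {0..T} (\<lambda>s. fv_field \<Delta>x (\<rho> s) (\<phi> (\<rho> s) (clip (u s))))
       \<longleftrightarrow> set_integrable lebesgue {0..T} (\<lambda>s. fv_field \<Delta>x (\<rho> s) (\<phi> (\<rho> s) (u s)))"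
      by (rule set_lebesgue_integral_spike(1)[OF N]) (simp add: eq)
    have 2: "(LINT s:{0..t}|lebesgue. fv_field \<Delta>x (\<rho> s) (\<phi> (\<rho> s) (clip (u s))))
       = (LINT s:{0..t}|lebesgue. fv_field \<Delta>x (\<rho> s) (\<phi> (\<rho> s) (u s)))" if "t \<in> {0..T}" for t
      by (rule set_lebesgue_integral_spike(2)[OF N]) (use that in \<open>simp add: eq\<close>)
    show ?thesis unfolding is_solution_def using 1 2 by simp
  qed
  then have "density_solution T \<Delta>x \<phi> \<rho>0 (\<lambda>t. clip (u t)) = density_solution T \<Delta>x \<phi> \<rho>0 u"
    by (simp add: density_solution_def)
  then have C: "cost_C T \<Delta>x \<phi> \<rho>0 \<chi>path (\<lambda>t. clip (u t)) = cost_C T \<Delta>x \<phi> \<rho>0 \<chi>path u"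
    by (simp add: cost_C_def)
  have S: "cost_S T Nmax (\<lambda>t. clip (u t)) = cost_S T Nmax u"
    unfolding cost_S_def by (rule set_lebesgue_integral_spike(2)[OF N]) (simp add: eq)
  have "TV T (\<lambda>t. clip (u t) $ i) = TV T (\<lambda>t. u t $ i)" for i
    unfolding TV_def
    by (intro SUP_cong refl arg_cong[where f=ereal] set_lebesgue_integral_spike(2)[OF N]) (simp add: eq)
  then have B: "cost_B T (\<lambda>t. clip (u t)) = cost_B T u" by (simp add: cost_B_def)
  show ?thesis by (simp add: cost_J_def C S B)
qed

lemma cost_S_nonneg: "0 \<le> cost_S T Nmax u"
  unfolding cost_S_def set_lebesgue_integral_def by (intro integral_nonneg_AE) auto

lemma cost_S_tendsto:
  fixes w :: "nat \<Rightarrow> real \<Rightarrow> real ^ 'r::finite"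
  assumes w: "\<And>n. w n \<in> boxed_controls T" and u: "u \<in> boxed_controls T"
    and N: "negligible N" and lim: "\<And>t. t \<in> {0..T} - N \<Longrightarrow> (\<lambda>n. w n t) \<longlonglongrightarrow> u t"
  shows "(\<lambda>n. cost_S T Nmax (w n)) \<longlonglongrightarrow> cost_S T Nmax u"
proof -
  define p where "p v = (max ((\<Sum>i\<in>UNIV. v $ i) - real Nmax) 0)\<^sup>2" for v :: "real ^ 'r"
  have pc: "continuous_on UNIV p" unfolding p_def by (intro continuous_intros)
  have pm: "(\<lambda>t. p (v t)) \<in> borel_measurable (lebesgue_on {0..T})" if "v \<in> boxed_controls T" for v
    using that by (intro borel_measurable_continuous_on[OF pc]) (simp add: boxed_controls_def)
  have pb: "norm (p (v t)) \<le> (real CARD('r))\<^sup>2" if "v \<in> boxed_controls T" for v t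
  proof -
    have "(\<Sum>i\<in>UNIV. v t $ i) \<le> (\<Sum>i\<in>(UNIV::'r set). 1)"
      using that by (intro sum_mono) (auto simp: boxed_controls_def control_box_def)
    then have "max ((\<Sum>i\<in>UNIV. v t $ i) - real Nmax) 0 \<le> real CARD('r)" by simp
    then show ?thesis unfolding p_def by (simp add: power_mono)
  qed
  have eq: "cost_S T Nmax v = integral {0..T} (\<lambda>t. p (v t))" if "v \<in> boxed_controls T" for v
    unfolding cost_S_def p_def[symmetric]
    by (rule set_lebesgue_integral_eq_integral(2)[OF
          bounded_measurable_absolutely_integrable[OF pm[OF that] pb[OF that]]])
  show ?thesis unfolding eq[OF w] eq[OF u]
  proof (rule bounded_convergence_ae[OF pm[OF w] pb[OF w] N])
    fix t assume t: "t \<in> {0..T} - N"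
    have "isCont p (u t)" using pc by (simp add: continuous_on_eq_continuous_at)
    then show "(\<lambda>n. p (w n t)) \<longlonglongrightarrow> p (u t)" using lim[OF t] by (rule isCont_tendsto_compose)
  qed
qed

lemma L1_norm_tendsto_0:
  fixes w :: "nat \<Rightarrow> real \<Rightarrow> real ^ 'r::finite"
  assumes w: "\<And>n. w n \<in> boxed_controls T" and u: "u \<in> boxed_controls T"
    and N: "negligible N" and lim: "\<And>t. t \<in> {0..T} - N \<Longrightarrow> (\<lambda>n. w n t) \<longlonglongrightarrow> u t"
  shows "(\<lambda>n. integral {0..T} (\<lambda>s. norm (w n s - u s))) \<longlonglongrightarrow> 0"
proof -
  have "(\<lambda>n. integral {0..T} (\<lambda>s. norm (w n s - u s))) \<longlonglongrightarrow> integral {0..T} (\<lambda>s::real. 0::real)"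
  proof (rule bounded_convergence_ae[OF _ _ N])
    fix n
    have [measurable]: "w n \<in> borel_measurable (lebesgue_on {0..T})" "u \<in> borel_measurable (lebesgue_on {0..T})"
      using w u by (auto simp: boxed_controls_def)
    show "(\<lambda>s. norm (w n s - u s)) \<in> borel_measurable (lebesgue_on {0..T})" by measurable
    fix t
    have "w n t \<in> control_box" "u t \<in> control_box" using w[of n] u by (auto simp: boxed_controls_def)
    then have "norm (w n t) \<le> CARD('r)" "norm (u t) \<le> CARD('r)" by (auto intro: control_box_norm_le)
    then show "norm (norm (w n t - u t)) \<le> 2 * real CARD('r)"
      using norm_triangle_ineq4[of "w n t" "u t"] by simp
  next
    fix t assume "t \<in> {0..T} - N"
    then have "(\<lambda>n. norm (w n t - u t)) \<longlonglongrightarrow> norm (u t - u t)" by (intro tendsto_intros lim)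
    then show "(\<lambda>n. norm (w n t - u t)) \<longlonglongrightarrow> 0" by simp
  qed
  then show ?thesis by simp
qed

section \<open>The direct method\<close>

lemma cost_J_minimizer:
  fixes \<Delta>x :: "'r::finite \<Rightarrow> 'c::{finite,linorder} \<Rightarrow> real"
  assumes net: "controlled_network T \<Delta>x \<phi> L" and \<theta>S: "0 \<le> \<theta>S" and \<theta>B: "0 < \<theta>B"
  shows "\<exists>u\<in>admissible_controls T.
           cost_J T \<Delta>x \<phi> \<rho>0 \<chi>path Nmax \<theta>S \<theta>B u
             = (INF v\<in>admissible_controls T. cost_J T \<Delta>x \<phi> \<rho>0 \<chi>path Nmax \<theta>S \<theta>B v)"
proof -
  interpret controlled_network T \<Delta>x \<phi> \<rho>0 L by (rule net)
  define J where "J = cost_J T \<Delta>x \<phi> \<rho>0 \<chi>path Nmax \<theta>S \<theta>B"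
  define C where "C = cost_C T \<Delta>x \<phi> \<rho>0 \<chi>path"
  define S :: "(real \<Rightarrow> 'r controls) \<Rightarrow> real" where "S = cost_S T Nmax"
  define I where "I = (INF v\<in>admissible_controls T. J v)"
  have Jeq: "J u = ereal (C u) + ereal (\<theta>S / 2 * S u) + ereal \<theta>B * cost_B T u" for u
    by (simp add: J_def C_def S_def cost_J_def)
  obtain B K where B: "0 \<le> B"
    "\<And>u i j. u \<in> boxed_controls T \<Longrightarrow> \<bar>density_solution T \<Delta>x \<phi> \<rho>0 u T $ i $ j\<bar> \<le> B"
    and K: "\<And>u v. u \<in> boxed_controls T \<Longrightarrow> v \<in> boxed_controls T \<Longrightarrow>
      norm (density_solution T \<Delta>x \<phi> \<rho>0 u T - density_solution T \<Delta>x \<phi> \<rho>0 v T)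
        \<le> K * integral {0..T} (\<lambda>s. norm (u s - v s))"
    by (rule density_solution_bounded_stable) blast
  define c where "c = (\<Sum>i\<in>\<chi>path. \<Sum>j\<in>(UNIV::'c set). B)"
  have Cge: "- c \<le> C u" if "u \<in> boxed_controls T" for u
  proof -
    have "- c = (\<Sum>i\<in>\<chi>path. \<Sum>j\<in>(UNIV::'c set). - B)" by (simp add: c_def sum_negf)
    also have "\<dots> \<le> C u"
      unfolding C_def cost_C_def
    proof (intro sum_mono)
      fix i j
      show "- B \<le> density_solution T \<Delta>x \<phi> \<rho>0 u T $ i $ j" using B(2)[OF that, of i j] by linarith
    qed
    finally show ?thesis .
  qed
  have S0: "0 \<le> \<theta>S / 2 * S u" for u using \<theta>S by (simp add: S_def cost_S_nonneg)
  have cB0: "0 \<le> cost_B T u" for u :: "real \<Rightarrow> real ^ 'r"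
    unfolding cost_B_def by (intro sum_nonneg TV_nonneg)
  have Jge: "ereal (- c) \<le> J u" if u: "u \<in> boxed_controls T" for u
  proof -
    have "ereal (- c) + 0 \<le> ereal (C u + \<theta>S / 2 * S u) + ereal \<theta>B * cost_B T u"
      using Cge[OF u] S0[of u] \<theta>B cB0[of u] by (intro add_mono) auto
    then show ?thesis by (simp add: Jeq)
  qed
  have Jclip: "J (\<lambda>t. clip (u t)) = J u" if "u \<in> admissible_controls T" for u
    unfolding J_def using that by (rule cost_J_clip)
  have Jge': "ereal (- c) \<le> J u" if "u \<in> admissible_controls T" for u
    using Jge[OF clip_boxed_control[OF that]] Jclip[OF that] by simp
  have Ige: "ereal (- c) \<le> I" unfolding I_def by (intro INF_greatest Jge')
  have z: "(\<lambda>_. 0) \<in> admissible_controls T"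
    by (intro boxed_controls_admissible) (simp add: boxed_controls_def zero_in_control_box)
  show ?thesis
  proof (cases "I = \<infinity>")
    case True
    have "I \<le> J (\<lambda>_. 0)" unfolding I_def using z by (rule INF_lower)
    then show ?thesis using True z by (intro bexI[OF _ z]) (simp add: I_def J_def)
  next
    case False
    then obtain m where m: "I = ereal m" using Ige by (cases I) auto
    have "\<exists>v\<in>boxed_controls T. J v < ereal (m + 1 / real (Suc n))" for n
    proof -
      have "I < ereal (m + 1 / real (Suc n))" by (simp add: m)
      then obtain u where u: "u \<in> admissible_controls T" "J u < ereal (m + 1 / real (Suc n))"
        unfolding I_def by (auto simp: INF_less_iff)
      then show ?thesis
        using clip_boxed_control[OF u(1)] Jclip[OF u(1)] by (intro bexI[of _ "\<lambda>t. clip (u t)"]) simp_all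
    qed
    then obtain v where v: "\<And>n. v n \<in> boxed_controls T" and vJ: "\<And>n. J (v n) < ereal (m + 1 / real (Suc n))"
      by metis
    define M where "M = (m + 1 + c) / \<theta>B"
    have cB: "cost_B T (v n) \<le> ereal M" for n
    proof (cases "cost_B T (v n)")
      case (real \<beta>)
      have "C (v n) + \<theta>S / 2 * S (v n) + \<theta>B * \<beta> < m + 1 / real (Suc n)"
        using vJ[of n] by (simp add: Jeq real)
      also have "\<dots> \<le> m + 1" by simp
      finally have "\<theta>B * \<beta> \<le> m + 1 + c" using Cge[OF v[of n]] S0[of "v n"] by linarith
      then show ?thesis using \<theta>B by (simp add: real M_def field_simps)
    next
      case PInf
      then show ?thesis using vJ[of n] \<theta>B by (simp add: Jeq)
    qed (use cB0[of "v n"] in auto)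
    have TVle: "TV T (\<lambda>t. v n t $ i) \<le> ereal M" for n i
    proof -
      have "TV T (\<lambda>t. v n t $ i) \<le> TV T (\<lambda>t. v n t $ i) + (\<Sum>i\<in>UNIV - {i}. TV T (\<lambda>t. v n t $ i))"
        by (intro add_increasing2 sum_nonneg TV_nonneg order_refl)
      also have "\<dots> = cost_B T (v n)" unfolding cost_B_def by (rule sum.remove[symmetric]) auto
      also have "\<dots> \<le> ereal M" by (rule cB)
      finally show ?thesis .
    qed
    define b where "b n = (\<chi> i. real_of_ereal (TV T (\<lambda>t. v n t $ i)))" for n
    have TVb: "TV T (\<lambda>t. v n t $ i) = ereal (b n $ i)" for n i
      using TVle[of n i] TV_nonneg[of T "\<lambda>t. v n t $ i"]
      by (cases "TV T (\<lambda>t. v n t $ i)") (auto simp: b_def)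
    have bb: "\<bar>b n $ i\<bar> \<le> M" for n i
      using TVle[of n i] TV_nonneg[of T "\<lambda>t. v n t $ i"] by (simp add: TVb)
    have vm: "v n \<in> borel_measurable (lebesgue_on {0..T})" and vb: "v n t \<in> control_box" for n t
      using v[of n] by (auto simp: boxed_controls_def)
    obtain r u where r: "strict_mono (r :: nat \<Rightarrow> nat)"
      and um: "u \<in> borel_measurable (lebesgue_on {0..T})" and ub: "\<And>t. u t \<in> control_box"
      and ae: "AE t in lebesgue_on {0..T}. (\<lambda>n. v (r n) t) \<longlonglongrightarrow> u t"
      by (rule TV_bounded_compact[of T v M, OF T_pos vm vb TVle]) blast
    have u: "u \<in> boxed_controls T" using um ub by (simp add: boxed_controls_def)
    obtain N where N: "negligible N" and vlim: "\<And>t. t \<in> {0..T} - N \<Longrightarrow> (\<lambda>n. v (r n) t) \<longlonglongrightarrow> u t"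
      using ae by (rule AE_lebesgue_on_imp_negligible) auto
    \<comment> \<open>A further subsequence makes the total variations themselves converge, so that lower
       semicontinuity can be used component by component.\<close>
    have "norm (b n) \<le> (\<Sum>i\<in>(UNIV::'r set). M)" for n
      by (rule order_trans[OF norm_le_l1_cart]) (intro sum_mono bb)
    then have "bounded (range (\<lambda>n. b (r n)))" by (auto simp: bounded_iff)
    then obtain b0 s where s: "strict_mono (s :: nat \<Rightarrow> nat)" and b0: "(\<lambda>n. b (r (s n))) \<longlonglongrightarrow> b0"
      using bounded_imp_convergent_subsequence by (force simp: o_def)
    define w where "w n = v (r (s n))" for n
    have w: "w n \<in> boxed_controls T" for n unfolding w_def by (rule v)
    have wlim: "(\<lambda>n. w n t) \<longlonglongrightarrow> u t" if "t \<in> {0..T} - N" for t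
      using LIMSEQ_subseq_LIMSEQ[OF vlim[OF that] s] by (simp add: w_def o_def)
    have TVu: "TV T (\<lambda>t. u t $ i) \<le> ereal (b0 $ i)" for i
    proof (rule TV_lower_semicontinuous[OF _ _ _ _ N])
      show "(\<lambda>t. w n t $ i) \<in> borel_measurable (lebesgue_on {0..T})" for n
        using w[of n] by (intro borel_measurable_vec_nth) (simp add: boxed_controls_def)
      show "(\<lambda>t. u t $ i) \<in> borel_measurable (lebesgue_on {0..T})"
        using um by (rule borel_measurable_vec_nth)
      show "\<bar>w n t $ i\<bar> \<le> 1" for n t
        using w[of n] by (auto simp: boxed_controls_def control_box_def)
      show "\<bar>u t $ i\<bar> \<le> 1" for t using ub[of t] by (auto simp: control_box_def)
      show "(\<lambda>n. w n t $ i) \<longlonglongrightarrow> u t $ i" if "t \<in> {0..T} - N" for t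
        by (intro tendsto_vec_nth wlim that)
      show "TV T (\<lambda>t. w n t $ i) \<le> ereal (b (r (s n)) $ i)" for n by (simp add: w_def TVb)
      show "(\<lambda>n. b (r (s n)) $ i) \<longlonglongrightarrow> b0 $ i" by (intro tendsto_vec_nth b0)
    qed
    have dlim: "(\<lambda>n. density_solution T \<Delta>x \<phi> \<rho>0 (w n) T) \<longlonglongrightarrow> density_solution T \<Delta>x \<phi> \<rho>0 u T"
    proof -
      have 0: "(\<lambda>n. K * integral {0..T} (\<lambda>s. norm (w n s - u s))) \<longlonglongrightarrow> 0"
        using tendsto_mult_left[OF L1_norm_tendsto_0[OF w u N wlim], of K] by simp
      have "(\<lambda>n. density_solution T \<Delta>x \<phi> \<rho>0 (w n) T - density_solution T \<Delta>x \<phi> \<rho>0 u T) \<longlonglongrightarrow> 0"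
        by (rule Lim_null_comparison[OF _ 0]) (intro always_eventually allI K w u)
      then show ?thesis by (simp add: LIM_zero_iff)
    qed
    have Clim: "(\<lambda>n. C (w n)) \<longlonglongrightarrow> C u"
      unfolding C_def cost_C_def by (intro tendsto_sum tendsto_vec_nth dlim)
    have Slim: "(\<lambda>n. S (w n)) \<longlonglongrightarrow> S u"
      unfolding S_def by (rule cost_S_tendsto[OF w u N wlim])
    have lim: "(\<lambda>n. C (w n) + \<theta>S / 2 * S (w n) + \<theta>B * (\<Sum>i\<in>UNIV. b (r (s n)) $ i))
        \<longlonglongrightarrow> C u + \<theta>S / 2 * S u + \<theta>B * (\<Sum>i\<in>UNIV. b0 $ i)"
      by (intro tendsto_intros Clim Slim b0)
    have lim': "(\<lambda>n. m + inverse (real (Suc (r (s n))))) \<longlonglongrightarrow> m + 0"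
      using LIMSEQ_subseq_LIMSEQ[OF LIMSEQ_inverse_real_of_nat, of "\<lambda>n. r (s n)"] r s
      by (intro tendsto_add tendsto_const) (simp add: o_def strict_mono_def)
    have le: "C (w n) + \<theta>S / 2 * S (w n) + \<theta>B * (\<Sum>i\<in>UNIV. b (r (s n)) $ i)
        \<le> m + inverse (real (Suc (r (s n))))" for n
    proof -
      have "cost_B T (w n) = ereal (\<Sum>i\<in>UNIV. b (r (s n)) $ i)"
        by (simp add: cost_B_def w_def TVb)
      then show ?thesis using vJ[of "r (s n)"] by (simp add: Jeq w_def inverse_eq_divide less_imp_le)
    qed
    \<comment> \<open>The limit of the costs of the minimizing sequence.\<close>
    have fin: "C u + \<theta>S / 2 * S u + \<theta>B * (\<Sum>i\<in>UNIV. b0 $ i) \<le> m"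
      using LIMSEQ_le[OF lim lim'] le by auto
    have "cost_B T u \<le> (\<Sum>i\<in>UNIV. ereal (b0 $ i))"
      unfolding cost_B_def by (intro sum_mono TVu)
    also have "\<dots> = ereal (\<Sum>i\<in>UNIV. b0 $ i)" by simp
    finally have cBu: "ereal \<theta>B * cost_B T u \<le> ereal \<theta>B * ereal (\<Sum>i\<in>UNIV. b0 $ i)"
      using \<theta>B by (intro ereal_mult_left_mono) auto
    have "J u \<le> ereal (C u) + ereal (\<theta>S / 2 * S u) + ereal \<theta>B * ereal (\<Sum>i\<in>UNIV. b0 $ i)"
      unfolding Jeq by (intro add_left_mono cBu)
    also have "\<dots> \<le> I" using fin by (simp add: m)
    finally have "J u \<le> I" .
    moreover have "I \<le> J u"
      unfolding I_def using boxed_controls_admissible[OF u] by (rule INF_lower)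
    ultimately show ?thesis
      using boxed_controls_admissible[OF u] unfolding I_def J_def by (intro bexI) auto
  qed
qed

theorem theorem1:
  fixes T \<theta>S \<theta>B :: real
    and \<Delta>x :: "'r::finite \<Rightarrow> 'c::{finite,linorder} \<Rightarrow> real"
    and \<phi> :: "('c, 'r) densities \<Rightarrow> 'r controls \<Rightarrow> 'r fluxes"
    and \<rho>0 :: "('c, 'r) densities"
    and \<chi>path :: "'r set"
    and Nmax :: nat
  assumes "T > 0"
    and "\<And>i j. \<Delta>x i j > 0"
    and "regular_junction_map \<phi>"
    and "Nmax \<ge> 1"
    and "\<theta>S \<ge> 0"
    and "\<theta>B > 0"
  shows "\<exists>u\<in>admissible_controls T.
           cost_J T \<Delta>x \<phi> \<rho>0 \<chi>path Nmax \<theta>S \<theta>B u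
             = (INF v\<in>admissible_controls T. cost_J T \<Delta>x \<phi> \<rho>0 \<chi>path Nmax \<theta>S \<theta>B v)"
proof -
  obtain L where "L-lipschitz_on (UNIV \<times> control_box) (\<lambda>(\<rho>, w). \<phi> \<rho> w)"
    using assms(3) unfolding regular_junction_map_def by blast
  then have "controlled_network T \<Delta>x \<phi> L"
    using assms(1,2) by unfold_locales auto
  then show ?thesis using assms(5,6) by (rule cost_J_minimizer)
qed

end
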